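(* Let $n\ge1$ be an integer, $0<s<\frac12$, and suppose that $\Omega\subset\mathbb{R}^n$ is a Lipschitz set. Suppose there exist a bounded open Lipschitz set $U\subset\mathbb{R}^n$ and a sequence $(\lambda_k)_{k}$ of positive real numbers tending to infinity such that $\mathcal{L}^n(\lambda_kU\cap\Omega)>0$ for all $k$ and $$\lim_{k\to\infty}\frac{1}{\mathcal{L}^n(\lambda_kU\cap\Omega)}\int_{\lambda_kU\cap\Omega}\frac{dx}{\operatorname{dist}(x,(\lambda_kU)^c)^{2s}}=0,$$ where $\lambda_kU=\{\lambda_kx:\ x\in U\}$. Then $P^1_{n,s}(\Omega)=0$.
   Context: $\mathcal{L}^n$ is Lebesgue measure on $\mathbb{R}^n$ and $A^c=\mathbb{R}^n\setminus A$. A Lipschitz set is an open set whose boundary is locally (up to a rigid motion) the graph of a Lipschitz function, with the set lying locally on one side of the graph. For $0<s<1$ set $C_{n,s}=\dfrac{s\,2^{2s}\,\Gamma\left(\frac{n+2s}{2}\right)}{\pi^{n/2}\,\Gamma(1-s)}$. For an open set $\Omega\subset\mathbb{R}^n$ let $[u]_{s,2,\Omega}=\left(\frac{C_{n,s}}{2}\int_\Omega\int_\Omega\frac{|u(x)-u(y)|^2}{|x-y|^{n+2s}}\,dx\,dy\right)^{1/2}$, and let $W^{s,2}_0(\Omega)$ be the closure of $C_c^\infty(\Omega)$ in the norm $\left(\|u\|_{L^2(\Omega)}^2+[u]_{s,2,\Omega}^2\right)^{1/2}$. Define $$P^1_{n,s}(\Omega)=\inf_{u\in W^{s,2}_0(\Omega),\,u\ne0}\frac{[u]_{s,2,\Omega}^2}{\int_\Omega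 u^2}.$$ *)

theory Defs
  imports "HOL-Analysis.Analysis"
begin

text \<open>
  An open set whose boundary is locally, up to a rigid motion, the graph of a Lipschitz function,
  with the set on one side of it. The rigid motion is encoded by a unit vector \<open>e\<close>, the direction of the last coordinate after
  the motion; the space of the remaining coordinates is the hyperplane orthogonal to \<open>e\<close>, on
  which the Lipschitz function \<open>g\<close> is defined, and \<open>x - (x \<bullet> e) *\<^sub>R e\<close> is the projection onto it.
  In dimension one the hyperplane is the origin and \<open>g\<close> is a constant. The Lipschitz constants
  are not required to be uniform along the boundary.
\<close>

definition lipschitz_set :: "'a::euclidean_space set \<Rightarrow> bool" where
  "lipschitz_set S \<longleftrightarrow>
     open S \<and>
     (\<forall>p\<in>frontier S. \<exists>V e g L.
        open V \<and> p \<in> V \<and> norm e = 1 \<and> L-lipschitz_on {y. y \<bullet> e = 0} g \<and>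
        frontier S \<inter> V = {x\<in>V. x \<bullet> e = g (x - (x \<bullet> e) *\<^sub>R e)} \<and>
        S \<inter> V = {x\<in>V. x \<bullet> e > g (x - (x \<bullet> e) *\<^sub>R e)})"

primrec C_k :: "nat \<Rightarrow> ('a::euclidean_space \<Rightarrow> real) \<Rightarrow> bool" where
  "C_k 0 f \<longleftrightarrow> continuous_on UNIV f"
| "C_k (Suc k) f \<longleftrightarrow>
     (\<forall>x. f differentiable (at x)) \<and> (\<forall>v. C_k k (\<lambda>x. frechet_derivative f (at x) v))"

definition test_functions :: "'a::euclidean_space set \<Rightarrow> ('a \<Rightarrow> real) set" where
  "test_functions S =
     {f. (\<forall>k. C_k k f) \<and> compact (closure {x. f x \<noteq> 0}) \<and> closure {x. f x \<noteq> 0} \<subseteq> S}"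

definition frac_const :: "nat \<Rightarrow> real \<Rightarrow> real" where
  "frac_const n s =
     s * 2 powr (2 * s) * Gamma ((real n + 2 * s) / 2) / (pi powr (real n / 2) * Gamma (1 - s))"

text \<open>On the diagonal the integrand is \<open>0 / 0 = 0\<close>; the diagonal is a null set.\<close>

definition gagliardo_integral :: "real \<Rightarrow> 'a::euclidean_space set \<Rightarrow> ('a \<Rightarrow> real) \<Rightarrow> ennreal" where
  "gagliardo_integral s S u =
     (\<integral>\<^sup>+ x. (\<integral>\<^sup>+ y. ennreal (\<bar>u x - u y\<bar>\<^sup>2 / norm (x - y) powr (real DIM('a) + 2 * s))
        \<partial>lebesgue_on S) \<partial>lebesgue_on S)"

text \<open>
  Functions on \<open>S\<close> are represented by total functions, of which only the values on \<open>S\<close> (up to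
  null sets) matter. The real-valued seminorm and norm are meaningful only on \<open>frac_sobolev s S\<close>,
  where the integrals involved are finite.
\<close>

definition frac_sobolev :: "real \<Rightarrow> 'a::euclidean_space set \<Rightarrow> ('a \<Rightarrow> real) set" where
  "frac_sobolev s S =
     {u \<in> borel_measurable (lebesgue_on S).
        integrable (lebesgue_on S) (\<lambda>x. (u x)\<^sup>2) \<and> gagliardo_integral s S u < \<infinity>}"

definition gagliardo_seminorm :: "real \<Rightarrow> 'a::euclidean_space set \<Rightarrow> ('a \<Rightarrow> real) \<Rightarrow> real" where
  "gagliardo_seminorm s S u =
     sqrt (frac_const DIM('a) s / 2 * enn2real (gagliardo_integral s S u))"

definition frac_sobolev_norm :: "real \<Rightarrow> 'a::euclidean_space set \<Rightarrow> ('a \<Rightarrow> real) \<Rightarrow> real" where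
  "frac_sobolev_norm s S u =
     sqrt ((\<integral>x. (u x)\<^sup>2 \<partial>lebesgue_on S) + (gagliardo_seminorm s S u)\<^sup>2)"

definition frac_sobolev0 :: "real \<Rightarrow> 'a::euclidean_space set \<Rightarrow> ('a \<Rightarrow> real) set" where
  "frac_sobolev0 s S =
     {u \<in> frac_sobolev s S.
        \<forall>\<epsilon>>0. \<exists>\<phi>\<in>test_functions S. frac_sobolev_norm s S (\<lambda>x. u x - \<phi> x) < \<epsilon>}"

text \<open>
  The infimum is taken in \<^typ>\<open>ennreal\<close>, so that it is infinite when there is no nonzero function.
\<close>

definition poincare_const :: "real \<Rightarrow> 'a::euclidean_space set \<Rightarrow> ennreal" where
  "poincare_const s S =
     (INF u \<in> {u \<in> frac_sobolev0 s S. \<not> (AE x in lebesgue_on S. u x = 0)}.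
        ennreal ((gagliardo_seminorm s S u)\<^sup>2 / (\<integral>x. (u x)\<^sup>2 \<partial>lebesgue_on S)))"

end

theory Submission
  imports Defs
begin

text \<open>
  Let \<open>W = \<lambda>\<^sub>k U\<close> and \<open>A = W \<inter> \<Omega>\<close>. Instead of showing that the indicator of \<open>A\<close> belongs to the closure of the
  test functions, we test directly with a smooth \<open>1 / \<delta>\<close>-Lipschitz cutoff of \<open>A\<close>, equal to \<open>1\<close> at distance
  \<open>3 * \<delta>\<close> from the complement. A pair of points of \<open>\<Omega>\<close> at which it differs either consists of a point of
  the core and a point outside \<open>W\<close>, so that it contributes to the integral of \<open>dist(x, W\<^sup>c) powr (-2 * s)\<close>, or
  has a point in the transition layer. The part of the layer close to the complement of \<open>W\<close> is absorbed by
  the same integral; the rest lies in the \<open>3 * \<delta>\<close>-neighbourhood of a compact piece of the Lipschitz boundary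
  of \<open>\<Omega>\<close>, which has measure \<open>O(\<delta>)\<close>, so that its energy is \<open>O(\<delta> powr (1 - 2 * s))\<close> and vanishes as \<open>\<delta>\<close>
  tends to \<open>0\<close> because \<open>s < 1 / 2\<close>.
\<close>

subsection \<open>Smooth cutoff functions\<close>

text \<open>The flat function \<open>exp (- (1 / t))\<close> times a polynomial in
  \<open>1 / t\<close>: the smallest convenient family that contains all its derivatives, since
  differentiating only replaces \<open>p\<close> by X^2 (p - p').\<close>

definition flat_exp :: "real poly \<Rightarrow> real \<Rightarrow> real" where
  "flat_exp p t = (if t > 0 then poly p (1 / t) * exp (- (1 / t)) else 0)"

lemma poly_times_exp_tendsto_0: "((\<lambda>x::real. poly p x * exp (- x)) \<longlongrightarrow> 0) at_top"
proof -
  have "((\<lambda>x::real. \<Sum>i\<le>degree p. coeff p i * (x ^ i / exp x)) \<longlongrightarrow> (\<Sum>i\<le>degree p. coeff p i * 0)) at_top"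
    by (intro tendsto_intros tendsto_power_div_exp_0)
  then show ?thesis
    by (simp add: poly_altdef sum_divide_distrib exp_minus field_simps)
qed

text \<open>Away from the origin this is the chain rule. At the origin the exponential beats every
  power of \<open>1 / t\<close>, so both one-sided difference quotients tend to 0.\<close>

lemma flat_exp_has_real_derivative:
  "(flat_exp p has_real_derivative flat_exp ([:0, 0, 1:] * (p - pderiv p)) t) (at t)"
proof -
  consider "t > 0" | "t < 0" | "t = 0" by linarith
  then show ?thesis
  proof cases
    case 1
    have "((\<lambda>t. poly p (1 / t) * exp (- (1 / t))) has_real_derivative
        flat_exp ([:0, 0, 1:] * (p - pderiv p)) t) (at t)"
      using 1 by (auto intro!: derivative_eq_intros DERIV_chain2[OF poly_DERIV]
          simp: flat_exp_def field_simps power2_eq_square)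
    then show ?thesis
      by (rule DERIV_cong_ev[THEN iffD1, rotated 3])
         (use 1 in \<open>auto simp: flat_exp_def intro!: eventually_mono[OF eventually_nhds_in_open[of "{0<..}"]]\<close>)
  next
    case 2
    have "((\<lambda>t. 0) has_real_derivative flat_exp ([:0, 0, 1:] * (p - pderiv p)) t) (at t)"
      using 2 by (simp add: flat_exp_def)
    then show ?thesis
      by (rule DERIV_cong_ev[THEN iffD1, rotated 3])
         (use 2 in \<open>auto simp: flat_exp_def intro!: eventually_mono[OF eventually_nhds_in_open[of "{..<0}"]]\<close>)
  next
    case 3
    have "((\<lambda>h. flat_exp p h / h) \<longlongrightarrow> 0) (at_right 0)"
    proof -
      \<comment> \<open>Dividing by \<open>h\<close> multiplies the polynomial in
        \<open>1 / h\<close> by its variable, which is what \<open>pCons 0 p\<close> does.\<close>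
      have "((\<lambda>h::real. poly (pCons 0 p) (inverse h) * exp (- inverse h)) \<longlongrightarrow> 0) (at_right 0)"
        by (rule filterlim_compose[OF poly_times_exp_tendsto_0 filterlim_inverse_at_top_right])
      then show ?thesis
        by (rule Lim_transform_eventually)
           (auto simp: eventually_at_filter flat_exp_def field_simps)
    qed
    moreover have "((\<lambda>h. flat_exp p h / h) \<longlongrightarrow> 0) (at_left 0)"
      by (rule Lim_transform_eventually[OF tendsto_const])
         (auto simp: eventually_at_filter flat_exp_def)
    ultimately have "((\<lambda>h. flat_exp p h / h) \<longlongrightarrow> 0) (at 0)"
      by (simp add: filterlim_split_at_real)
    then show ?thesis
      using 3 by (simp add: DERIV_def flat_exp_def)
  qed
qed

text \<open>
  Closing up under sums and products makes the class closed under directional derivatives,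
  from which smoothness follows without computing any higher derivative.
\<close>

inductive bump_algebra :: "real \<Rightarrow> ('a::euclidean_space \<Rightarrow> real) \<Rightarrow> bool" for r where
  flat: "bump_algebra r (\<lambda>x. flat_exp p (r\<^sup>2 - x \<bullet> x))"
| inner: "bump_algebra r (\<lambda>x. x \<bullet> v)"
| const: "bump_algebra r (\<lambda>x. c)"
| add: "bump_algebra r f \<Longrightarrow> bump_algebra r g \<Longrightarrow> bump_algebra r (\<lambda>x. f x + g x)"
| mult: "bump_algebra r f \<Longrightarrow> bump_algebra r g \<Longrightarrow> bump_algebra r (\<lambda>x. f x * g x)"

text \<open>By the chain rule a flat generator differentiates into another flat generator times a
  linear form; linear forms differentiate into constants, and sums and products follow from the
  usual rules.\<close>

lemma bump_algebra_derivative: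
  assumes "bump_algebra r f"
  shows "\<exists>f'. (\<forall>x. (f has_derivative f' x) (at x)) \<and> (\<forall>v. bump_algebra r (\<lambda>x. f' x v))"
  using assms
proof induction
  case (flat p)
  let ?q = "[:0, 0, 1:] * (p - pderiv p)"
  have "((\<lambda>x. flat_exp p (r\<^sup>2 - x \<bullet> x)) has_derivative
      (\<lambda>v. flat_exp ?q (r\<^sup>2 - x \<bullet> x) * (- 2 * (x \<bullet> v)))) (at x)" for x :: 'a
    by (rule has_derivative_eq_rhs,
        rule has_derivative_compose[OF _ flat_exp_has_real_derivative[unfolded has_field_derivative_def]],
        (rule derivative_intros)+)
       (auto simp: inner_commute simp del: mult_pCons_left)
  moreover have "bump_algebra r (\<lambda>x. flat_exp ?q (r\<^sup>2 - x \<bullet> x) * (- 2 * (x \<bullet> v)))" for v :: 'a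
    by (intro bump_algebra.intros)
  ultimately show ?case
    by (intro exI[of _ "\<lambda>x v. flat_exp ?q (r\<^sup>2 - x \<bullet> x) * (- 2 * (x \<bullet> v))"]) auto
next
  case (inner v)
  have "((\<lambda>x. x \<bullet> v) has_derivative (\<lambda>h. h \<bullet> v)) (at x)" for x :: 'a
    by (rule derivative_eq_intros | simp)+
  then show ?case
    by (intro exI[of _ "\<lambda>x h. h \<bullet> v"]) (auto intro: bump_algebra.intros)
next
  case (const c)
  then show ?case
    by (intro exI[of _ "\<lambda>x h. 0"]) (auto intro: bump_algebra.intros)
next
  case (add f g)
  then obtain f' g' where
    "\<And>x. (f has_derivative f' x) (at x)" "\<And>v. bump_algebra r (\<lambda>x. f' x v)"
    "\<And>x. (g has_derivative g' x) (at x)" "\<And>v. bump_algebra r (\<lambda>x. g' x v)"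
    by blast
  then show ?case
    by (intro exI[of _ "\<lambda>x h. f' x h + g' x h"]) (auto intro: bump_algebra.intros derivative_intros)
next
  case (mult f g)
  then obtain f' g' where
    "\<And>x. (f has_derivative f' x) (at x)" "\<And>v. bump_algebra r (\<lambda>x. f' x v)"
    "\<And>x. (g has_derivative g' x) (at x)" "\<And>v. bump_algebra r (\<lambda>x. g' x v)"
    by blast
  with mult.hyps show ?case
    by (intro exI[of _ "\<lambda>x h. f x * g' x h + f' x h * g x"] conjI allI has_derivative_mult
        bump_algebra.add bump_algebra.mult)
qed

section \<open>Smoothness of convolutions with a bump\<close>

lemma bump_algebra_continuous: "bump_algebra r f \<Longrightarrow> continuous_on UNIV f"
  using bump_algebra_derivative has_derivative_continuous
  by (metis continuous_at_imp_continuous_on)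

text \<open>\<open>C_k (Suc k)\<close> only asks for \<open>C_k k\<close> of the directional
  derivatives, so a class of differentiable functions that contains its own directional derivatives
  is smooth by induction on \<open>k\<close>.\<close>

lemma C_k_of_derivative_closed:
  assumes closed: "\<And>f. P f \<Longrightarrow> \<exists>f'. (\<forall>x. (f has_derivative f' x) (at x)) \<and> (\<forall>v. P (\<lambda>x. f' x v))"
    and "P f"
  shows "C_k k f"
  using \<open>P f\<close>
proof (induction k arbitrary: f)
  case 0
  then show ?case
    using closed has_derivative_continuous
    by (metis C_k.simps(1) continuous_at_imp_continuous_on)
next
  case (Suc k)
  then obtain f' where f': "\<And>x. (f has_derivative f' x) (at x)" "\<And>v. P (\<lambda>x. f' x v)"
    using closed by blast
  then have "frechet_derivative f (at x) = f' x" for x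
    using frechet_derivative_at by metis
  with f' Suc.IH show ?case
    by (auto simp: differentiable_def)
qed

text \<open>Differentiation under the integral sign puts the derivative on the kernel, so the result
  is again a convolution of the same form and \<open>v\<close> need only be continuous.\<close>

lemma bump_convolution_derivative:
  assumes \<eta>: "bump_algebra r \<eta>" and v: "continuous_on UNIV v"
  shows "\<exists>F'. (\<forall>x. ((\<lambda>x. integral (cbox a b) (\<lambda>y. \<eta> (x - y) * v y)) has_derivative F' x) (at x)) \<and>
    (\<forall>w. \<exists>\<eta>'. bump_algebra r \<eta>' \<and>
      (\<lambda>x. F' x w) = (\<lambda>x. integral (cbox a b) (\<lambda>y. \<eta>' (x - y) * v y)))"
proof -
  obtain f' where f': "\<And>x. (\<eta> has_derivative f' x) (at x)" "\<And>v. bump_algebra r (\<lambda>x. f' x v)"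
    using bump_algebra_derivative[OF \<eta>] by blast
  \<comment> \<open>The Leibniz rule needs the derivative as a bounded linear map that is continuous
    in operator norm; in finite dimension this reduces to continuity of each directional
    derivative.\<close>
  define D where "D x = Blinfun (f' x)" for x
  have D: "blinfun_apply (D x) = f' x" for x
    unfolding D_def using f'(1) by (intro bounded_linear_Blinfun_apply has_derivative_bounded_linear)
  have cD: "continuous_on UNIV D"
    by (rule continuous_on_blinfun_componentwise) (auto simp: D intro: bump_algebra_continuous f'(2))
  define fx where "fx x y = v y *\<^sub>R D (x - y)" for x y
  have cfx: "continuous_on (UNIV \<times> cbox a b) (\<lambda>(x, y). fx x y)"
    unfolding fx_def split_beta
    by (intro continuous_intros continuous_on_compose2[OF cD] continuous_on_compose2[OF v]) auto
  have cfx1: "continuous_on (cbox a b) (fx x)" for x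
    unfolding fx_def
    by (intro continuous_intros continuous_on_compose2[OF cD] continuous_on_compose2[OF v]) auto
  have der: "((\<lambda>x. integral (cbox a b) (\<lambda>y. \<eta> (x - y) * v y)) has_derivative
      integral (cbox a b) (fx x)) (at x)" for x
  proof (rule leibniz_rule[of UNIV, OF _ _ cfx])
    fix x y
    show "((\<lambda>x. \<eta> (x - y) * v y) has_derivative fx x y) (at x)"
      unfolding fx_def
      by (rule has_derivative_eq_rhs, rule has_derivative_mult_left,
          rule has_derivative_compose[OF _ f'(1)], (rule derivative_intros)+)
         (auto simp: D scaleR_blinfun.rep_eq mult.commute)
    show "(\<lambda>y. \<eta> (x - y) * v y) integrable_on cbox a b"
      by (intro integrable_continuous continuous_intros
          continuous_on_compose2[OF bump_algebra_continuous[OF \<eta>]] continuous_on_compose2[OF v]) auto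
  qed auto
  have "blinfun_apply (integral (cbox a b) (fx x)) w
      = integral (cbox a b) (\<lambda>y. f' (x - y) w * v y)" for x w
    using blinfun_apply_integral[OF integrable_continuous[OF cfx1], of x w]
    by (simp add: fx_def D scaleR_blinfun.rep_eq mult.commute)
  with der f'(2) show ?thesis
    by (intro exI[of _ "\<lambda>x. blinfun_apply (integral (cbox a b) (fx x))"]) auto
qed

lemma bump_convolution_C_k:
  assumes "bump_algebra r \<eta>" and v: "continuous_on UNIV v"
  shows "C_k k (\<lambda>x. integral (cbox a b) (\<lambda>y. \<eta> (x - y) * v y))"
  by (rule C_k_of_derivative_closed[where
        P="\<lambda>f. \<exists>\<eta>. bump_algebra r \<eta> \<and> f = (\<lambda>x. integral (cbox a b) (\<lambda>y. \<eta> (x - y) * v y))"])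
     (use bump_convolution_derivative[OF _ v] assms in blast)+

text \<open>Normalise the standard bump exp(-1/(r^2 - |x|^2)), which is positive exactly on the open
  ball of radius \<open>r\<close>.\<close>

lemma mollifier_exists:
  assumes "0 < r"
  obtains \<eta> :: "'a::euclidean_space \<Rightarrow> real" where "bump_algebra r \<eta>" "\<And>x. 0 \<le> \<eta> x"
    "\<And>x. r \<le> norm x \<Longrightarrow> \<eta> x = 0" "integrable lborel \<eta>" "integral\<^sup>L lborel \<eta> = 1"
proof -
  define f where "f x = flat_exp 1 (r\<^sup>2 - x \<bullet> x)" for x :: 'a
  have ba: "bump_algebra r f"
    unfolding f_def by (rule bump_algebra.flat)
  have pos: "f x > 0 \<longleftrightarrow> norm x < r" and f0: "f x \<ge> 0" for x
    using assms by (auto simp: f_def flat_exp_def norm_lt_square)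
  have eq0: "f x = 0" if "r \<le> norm x" for x
    using pos[of x] f0[of x] that by linarith
  have "integrable lborel (\<lambda>x. indicator (cball 0 r) x *\<^sub>R f x)"
    by (intro borel_integrable_compact continuous_on_subset[OF bump_algebra_continuous[OF ba]]) auto
  also have "(\<lambda>x. indicator (cball 0 r) x *\<^sub>R f x) = f"
    using eq0 by (auto simp: indicator_def fun_eq_iff)
  finally have int: "integrable lborel f" .
  \<comment> \<open>A nonnegative function with zero integral vanishes almost everywhere, but this
    one is positive on a ball of positive volume.\<close>
  have "integral\<^sup>L lborel f \<noteq> 0"
  proof
    assume "integral\<^sup>L lborel f = 0"
    then have "AE x in lborel. f x = 0"
      using int f0 by (simp add: integral_nonneg_eq_0_iff_AE)
    then have "AE x in lborel. x \<notin> ball (0::'a) r"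
    proof eventually_elim
      case (elim x)
      then show ?case using pos[of x] by simp
    qed
    then have "emeasure lborel (ball (0::'a) r) = 0"
      by (subst (asm) AE_iff_measurable[OF _ refl]) (auto simp: ball_def)
    then show False
      using assms unit_ball_vol_pos[of "real DIM('a)"] by (simp add: emeasure_ball)
  qed
  moreover have "integral\<^sup>L lborel f \<ge> 0"
    using f0 by simp
  ultimately have I: "integral\<^sup>L lborel f > 0" by simp
  define c where "c = 1 / integral\<^sup>L lborel f"
  have "0 < c" "c * integral\<^sup>L lborel f = 1"
    using I by (auto simp: c_def)
  then show ?thesis
    by (intro that[of "\<lambda>x. c * f x"] bump_algebra.mult[OF bump_algebra.const ba])
       (use f0 eq0 int in auto)
qed

lemma lborel_integral_reflect:
  fixes f :: "'a::euclidean_space \<Rightarrow> real"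
  assumes [measurable]: "f \<in> borel_measurable borel"
  shows "(\<integral>y. f y \<partial>lborel) = (\<integral>z. f (x - z) \<partial>lborel)"
  by (subst lborel_affine[of "-1" x])
     (auto simp: density_1 integral_distr)

text \<open>Mollify a truncated distance function. \<open>v\<close> is 0 up to distance
  \<open>\<delta>\<close> from the complement and 1 from distance \<open>2 * \<delta>\<close> on; a
  kernel of radius \<open>\<delta> / 2\<close> preserves the bounds and the Lipschitz constant and
  moves these thresholds by at most \<open>\<delta> / 2\<close>.\<close>

lemma smooth_cutoff_exists:
  fixes A :: "'a::euclidean_space set"
  assumes "open A" "bounded A" "0 < \<delta>"
  obtains \<phi> where "\<phi> \<in> test_functions A" "\<And>x. 0 \<le> \<phi> x" "\<And>x. \<phi> x \<le> 1"
    "(1 / \<delta>)-lipschitz_on UNIV \<phi>" "\<And>x. 3 * \<delta> \<le> infdist x (- A) \<Longrightarrow> \<phi> x = 1"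
proof -
  define v where "v x = min 1 (max 0 (infdist x (- A) / \<delta> - 1))" for x
  have v0: "0 \<le> v x" and v1: "v x \<le> 1" for x
    by (auto simp: v_def)
  have dlip: "\<bar>infdist x (- A) - infdist y (- A)\<bar> \<le> dist x y" for x y
    using infdist_triangle[of x "- A" y] infdist_triangle[of y "- A" x] by (simp add: dist_commute)
  have vlip: "\<bar>v x - v y\<bar> \<le> (1 / \<delta>) * dist x y" for x y
  proof -
    have "\<bar>v x - v y\<bar> \<le> \<bar>infdist x (- A) / \<delta> - infdist y (- A) / \<delta>\<bar>"
      by (simp add: v_def min_def max_def)
    also have "\<dots> = \<bar>infdist x (- A) - infdist y (- A)\<bar> / \<delta>"
      using \<open>0 < \<delta>\<close> by (simp flip: diff_divide_distrib)
    also have "\<dots> \<le> (1 / \<delta>) * dist x y"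
      using dlip[of x y] \<open>0 < \<delta>\<close> by (simp add: divide_right_mono)
    finally show ?thesis .
  qed
  have cv: "continuous_on UNIV v"
    unfolding v_def by (intro continuous_intros continuous_on_infdist) (use \<open>0 < \<delta>\<close> in auto)
  have [measurable]: "v \<in> borel_measurable borel"
    by (rule borel_measurable_continuous_onI[OF cv])
  have UA: "- A \<noteq> {}"
    using \<open>bounded A\<close> by (metis Compl_UNIV_eq compl_eq_compl_iff not_bounded_UNIV)
  have d0: "infdist x (- A) = 0" if "x \<notin> A" for x
    using that by simp
  obtain a b where ab: "A \<subseteq> cbox a b"
    using bounded_subset_cbox_symmetric[OF \<open>bounded A\<close>] by blast
  obtain \<eta> :: "'a \<Rightarrow> real" where \<eta>: "bump_algebra (\<delta> / 2) \<eta>" "\<And>x. 0 \<le> \<eta> x"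
    "\<And>x. \<delta> / 2 \<le> norm x \<Longrightarrow> \<eta> x = 0" "integrable lborel \<eta>" "integral\<^sup>L lborel \<eta> = 1"
    using mollifier_exists[of "\<delta> / 2"] \<open>0 < \<delta>\<close> by auto
  have [measurable]: "\<eta> \<in> borel_measurable borel"
    by (rule borel_measurable_continuous_onI[OF bump_algebra_continuous[OF \<eta>(1)]])
  have intv: "integrable lborel (\<lambda>z. \<eta> z * v (x - z))" for x
    by (rule Bochner_Integration.integrable_bound[OF \<eta>(4)])
       (use v0 v1 \<eta>(2) in \<open>auto simp: mult_left_le\<close>)
  define \<phi> where "\<phi> x = (\<integral>z. \<eta> z * v (x - z) \<partial>lborel)" for x
  \<comment> \<open>Two forms of one convolution are used: with \<open>x\<close> inside
    \<open>v\<close> it inherits bounds and Lipschitz constant from \<open>v\<close>, with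
    \<open>x\<close> inside \<open>\<eta>\<close> it is smooth. As \<open>v\<close> vanishes off
    \<open>A\<close>, the second form lives on a fixed box.\<close>
  have \<phi>_eq: "\<phi> x = integral (cbox a b) (\<lambda>y. \<eta> (x - y) * v y)" for x
  proof -
    have c: "continuous_on (cbox a b) (\<lambda>y. \<eta> (x - y) * v y)"
      by (intro continuous_intros continuous_on_compose2[OF bump_algebra_continuous[OF \<eta>(1)]]
          continuous_on_compose2[OF cv]) auto
    have "\<phi> x = (\<integral>y. \<eta> (x - y) * v y \<partial>lborel)"
      unfolding \<phi>_def by (subst lborel_integral_reflect[of _ x]) auto
    also have "\<dots> = (\<integral>y. indicator (cbox a b) y *\<^sub>R (\<eta> (x - y) * v y) \<partial>lborel)"
    proof (intro Bochner_Integration.integral_cong refl)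
      fix y
      show "\<eta> (x - y) * v y = indicator (cbox a b) y *\<^sub>R (\<eta> (x - y) * v y)"
        using ab d0[of y] by (cases "y \<in> A") (auto simp: v_def)
    qed
    also have "\<dots> = integral (cbox a b) (\<lambda>y. \<eta> (x - y) * v y)"
      using set_borel_integral_eq_integral(2)[of "cbox a b" "\<lambda>y. \<eta> (x - y) * v y"]
        borel_integrable_compact[OF compact_cbox c]
      by (simp add: set_integrable_def set_lebesgue_integral_def)
    finally show ?thesis .
  qed
  have p0: "0 \<le> \<phi> x" for x
    unfolding \<phi>_def using v0 \<eta>(2) by simp
  have p1: "\<phi> x \<le> 1" for x
  proof -
    have "\<phi> x \<le> integral\<^sup>L lborel \<eta>"
      unfolding \<phi>_def by (rule integral_mono[OF intv \<eta>(4)]) (use v0 v1 \<eta>(2) in \<open>auto simp: mult_left_le\<close>)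
    then show ?thesis by (simp add: \<eta>(5))
  qed
  have "\<bar>\<phi> x - \<phi> y\<bar> \<le> 1 / \<delta> * dist x y" for x y
  proof -
    have "\<bar>\<phi> x - \<phi> y\<bar> = \<bar>\<integral>z. \<eta> z * v (x - z) - \<eta> z * v (y - z) \<partial>lborel\<bar>"
      unfolding \<phi>_def by (subst Bochner_Integration.integral_diff[OF intv intv]) simp
    also have "\<dots> \<le> (\<integral>z. \<bar>\<eta> z * v (x - z) - \<eta> z * v (y - z)\<bar> \<partial>lborel)"
      by (rule integral_abs_bound)
    also have "\<dots> \<le> (\<integral>z. \<eta> z * (1 / \<delta> * dist x y) \<partial>lborel)"
    proof (rule integral_mono)
      show "integrable lborel (\<lambda>z. \<bar>\<eta> z * v (x - z) - \<eta> z * v (y - z)\<bar>)"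
        using intv by auto
      show "integrable lborel (\<lambda>z. \<eta> z * (1 / \<delta> * dist x y))"
        using \<eta>(4) by auto
      show "\<bar>\<eta> z * v (x - z) - \<eta> z * v (y - z)\<bar> \<le> \<eta> z * (1 / \<delta> * dist x y)" for z
        using mult_left_mono[OF vlip[of "x - z" "y - z"] \<eta>(2)[of z]] \<eta>(2)[of z]
        by (simp add: abs_mult dist_norm flip: right_diff_distrib)
    qed
    finally show ?thesis
      by (simp add: \<eta>(5))
  qed
  then have lip: "(1 / \<delta>)-lipschitz_on UNIV \<phi>"
    using \<open>0 < \<delta>\<close> by (auto intro!: lipschitz_onI simp: dist_real_def)
  have one: "\<phi> x = 1" if "3 * \<delta> \<le> infdist x (- A)" for x
  proof -
    have "\<eta> z * v (x - z) = \<eta> z" for z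
    proof (cases "\<delta> / 2 \<le> norm z")
      case False
      have "infdist (x - z) (- A) \<ge> 2 * \<delta>"
        using dlip[of x "x - z"] that False by (simp add: dist_norm)
      then have "v (x - z) = 1"
        using \<open>0 < \<delta>\<close> by (simp add: v_def field_simps min_def max_def)
      then show ?thesis by simp
    qed (simp add: \<eta>(3))
    then show ?thesis by (simp only: \<phi>_def \<eta>(5))
  qed
  have supp: "\<delta> / 2 \<le> infdist x (- A)" if "\<phi> x \<noteq> 0" for x
  proof (rule ccontr)
    assume far: "\<not> ?thesis"
    have "\<eta> z * v (x - z) = 0" for z
    proof (cases "\<delta> / 2 \<le> norm z")
      case False
      have "infdist (x - z) (- A) \<le> \<delta>"
        using dlip[of x "x - z"] far False by (simp add: dist_norm)
      then have "v (x - z) = 0"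
        using \<open>0 < \<delta>\<close> by (simp add: v_def field_simps min_def max_def)
      then show ?thesis by simp
    qed (simp add: \<eta>(3))
    then have "\<phi> x = 0" by (simp only: \<phi>_def) simp
    then show False using that by simp
  qed
  have "closure {x. \<phi> x \<noteq> 0} \<subseteq> {x. \<delta> / 2 \<le> infdist x (- A)}"
  proof (rule closure_minimal)
    show "closed {x. \<delta> / 2 \<le> infdist x (- A)}"
      by (intro closed_Collect_le continuous_intros)
  qed (use supp in blast)
  also have "\<dots> \<subseteq> A"
  proof safe
    fix x assume "\<delta> / 2 \<le> infdist x (- A)"
    then show "x \<in> A"
      using d0[of x] \<open>0 < \<delta>\<close> by (cases "x \<in> A") auto
  qed
  finally have clA: "closure {x. \<phi> x \<noteq> 0} \<subseteq> A" .
  then have "bounded {x. \<phi> x \<noteq> 0}"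
    using \<open>bounded A\<close> closure_subset by (meson bounded_subset)
  then have "\<phi> \<in> test_functions A"
    using clA bump_convolution_C_k[OF \<eta>(1) cv, of _ a b] by (simp add: test_functions_def \<phi>_eq[abs_def] compact_closure)
  with that p0 p1 lip one show ?thesis by blast
qed

subsection \<open>The truncated kernel\<close>

text \<open>The numerator models the squared increment of a 1-Lipschitz function with values in the
  unit interval. The type argument only fixes the dimension.\<close>

definition kernel_const :: "'a::euclidean_space itself \<Rightarrow> real \<Rightarrow> ennreal" where
  "kernel_const _ s =
     (\<integral>\<^sup>+ (z::'a). ennreal (min 1 ((norm z)\<^sup>2) / norm z powr (real DIM('a) + 2 * s)) \<partial>lborel)"

lemma nn_integral_sum_balls_finite:
  fixes r :: "nat \<Rightarrow> real"
  assumes r: "\<And>j. 0 \<le> r j" and c: "\<And>j. 0 \<le> c j" and sm: "summable (\<lambda>j. c j * r j ^ DIM('a))"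
  shows "(\<integral>\<^sup>+ z. (\<Sum>j. ennreal (c j) * indicator (ball (0::'a::euclidean_space) (r j)) z) \<partial>lborel) < \<infinity>"
proof -
  let ?u = "unit_ball_vol (real DIM('a))"
  have "(\<integral>\<^sup>+ z. (\<Sum>j. ennreal (c j) * indicator (ball (0::'a) (r j)) z) \<partial>lborel)
      = (\<Sum>j. ennreal (c j) * emeasure lborel (ball (0::'a) (r j)))"
    by (subst nn_integral_suminf)
       (auto simp: nn_integral_cmult_indicator intro!: borel_measurable_times_ennreal borel_measurable_indicator)
  also have "\<dots> = (\<Sum>j. ennreal (?u * (c j * r j ^ DIM('a))))"
    using r c by (intro suminf_cong) (simp add: emeasure_ball mult.left_commute unit_ball_vol_nonneg flip: ennreal_mult)
  also have "\<dots> = ennreal (\<Sum>j. ?u * (c j * r j ^ DIM('a)))"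
    using r c by (intro suminf_ennreal2 summable_mult sm) (auto simp: unit_ball_vol_nonneg)
  finally show ?thesis by simp
qed

lemma le_suminf_ennreal: "f (j::nat) \<le> (\<Sum>j. f j :: ennreal)"
  using sum_le_suminf[of f "{j}"] by simp

text \<open>Dyadic shells replace polar coordinates. On each shell the integrand is bounded by a
  constant, and constant times ball volume is a geometric sequence with ratio 2^(-2s) outside the
  unit ball and 2^(2s-2) inside; both are below 1.\<close>

lemma kernel_const_finite:
  assumes "0 < s" "s < 1"
  shows "kernel_const TYPE('a::euclidean_space) s < \<infinity>"
proof -
  define a where "a = real DIM('a) + 2 * s"
  have "a > 0" using assms by (simp add: a_def)
  \<comment> \<open>\<open>c1 j\<close> bounds the integrand on the shell from 2^j to 2^(j+1),
    \<open>c2 j\<close> on the shell from 2^(-j-1) to 2^(-j); \<open>r1\<close> and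
    \<open>r2\<close> are the outer radii.\<close>
  define c1 where "c1 j = (2 powr (- a)) ^ j" for j :: nat
  define c2 where "c2 j = (1 / 4) ^ j * (2 powr a) ^ Suc j" for j :: nat
  define r1 where "r1 j = (2::real) ^ Suc j" for j :: nat
  define r2 where "r2 j = (1 / 2 :: real) ^ j" for j :: nat
  have A: "2 powr (- a) * 2 ^ DIM('a) = 2 powr (- (2 * s))"
    by (simp add: a_def flip: powr_realpow powr_add)
  have B: "2 powr a / (4 * 2 ^ DIM('a)) = 2 powr (2 * s - 2)"
  proof -
    have "2 powr a = 2 powr (real DIM('a) + 2 + (2 * s - 2))"
      by (simp add: a_def)
    also have "\<dots> = 2 ^ DIM('a) * 4 * 2 powr (2 * s - 2)"
      unfolding powr_add by (simp add: powr_realpow)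
    finally show ?thesis by simp
  qed
  have "c1 j * r1 j ^ DIM('a) = 2 ^ DIM('a) * (2 powr (- (2 * s))) ^ j" for j
  proof -
    have "r1 j ^ DIM('a) = 2 ^ DIM('a) * (2 ^ DIM('a)) ^ j"
      by (simp add: r1_def power_mult_distrib mult.commute[of j] flip: power_mult)
    then show ?thesis
      by (simp add: c1_def power_mult_distrib flip: A)
  qed
  then have s1: "summable (\<lambda>j. c1 j * r1 j ^ DIM('a))"
    using assms by (simp add: powr_less_one summable_geometric summable_mult)
  have "c2 j * r2 j ^ DIM('a) = 2 powr a * (2 powr (2 * s - 2)) ^ j" for j
  proof -
    have "r2 j ^ DIM('a) = 1 / (2 ^ DIM('a)) ^ j"
      by (simp add: r2_def power_one_over mult.commute[of j] flip: power_mult)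
    then show ?thesis
      by (simp add: c2_def power_mult_distrib power_divide power_one_over flip: B)
  qed
  then have s2: "summable (\<lambda>j. c2 j * r2 j ^ DIM('a))"
    using assms by (simp add: powr_less_one summable_geometric summable_mult)
  have bound: "ennreal (min 1 ((norm z)\<^sup>2) / norm z powr a)
      \<le> (\<Sum>j. ennreal (c1 j) * indicator (ball 0 (r1 j)) z) + (\<Sum>j. ennreal (c2 j) * indicator (ball 0 (r2 j)) z)"
    for z :: 'a
  proof -
    consider "z = 0" | "norm z \<ge> 1" | "0 < norm z" "norm z < 1" by fastforce
    then show ?thesis
    proof cases
      case 1
      then show ?thesis by simp
    next
      case 2
      \<comment> \<open>Minimality gives the lower bound 2^j on the norm through the predecessor of
        \<open>j\<close>; for \<open>j = 0\<close> it is the case assumption.\<close>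
      define j where "j = (LEAST j. norm z < 2 ^ Suc j)"
      have "\<exists>j. norm z < 2 ^ j"
        using real_arch_pow[of 2 "norm z"] by simp
      then obtain i where "norm z < 2 ^ i" by blast
      then have "norm z < 2 ^ Suc i"
        unfolding power_Suc using norm_ge_zero[of z] by linarith
      then have j: "norm z < 2 ^ Suc j"
        unfolding j_def by (rule LeastI)
      have "2 ^ j \<le> norm z"
      proof (cases j)
        case (Suc k)
        then show ?thesis
          using not_less_Least[of k "\<lambda>j. norm z < 2 ^ Suc j"] unfolding j_def[symmetric] by simp
      qed (use 2 in simp)
      then have "(2 ^ j) powr a \<le> norm z powr a"
        using \<open>a > 0\<close> by (intro powr_mono2) auto
      moreover have "c1 j = 1 / (2 ^ j) powr a"
        by (simp add: c1_def powr_power powr_minus powr_powr field_simps flip: powr_realpow)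
      moreover have "min 1 ((norm z)\<^sup>2) \<le> 1" by simp
      ultimately have "min 1 ((norm z)\<^sup>2) / norm z powr a \<le> c1 j"
        using 2 by (auto intro!: frac_le)
      then have "ennreal (min 1 ((norm z)\<^sup>2) / norm z powr a) \<le> ennreal (c1 j) * indicator (ball 0 (r1 j)) z"
        using j by (simp add: r1_def ennreal_leI)
      also have "\<dots> \<le> (\<Sum>j. ennreal (c1 j) * indicator (ball 0 (r1 j)) z)"
        by (rule le_suminf_ennreal)
      finally show ?thesis
        by (rule order_trans) simp
    next
      case 3
      define j where "j = (LEAST j. (1 / 2) ^ Suc j \<le> norm z)"
      obtain i where "(1 / 2) ^ i < norm z"
        using real_arch_pow_inv[of "norm z" "1 / 2"] 3 by auto
      moreover have "(1 / 2 :: real) ^ Suc i \<le> (1 / 2) ^ i" by simp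
      ultimately have "(1 / 2) ^ Suc i \<le> norm z" by linarith
      then have j: "(1 / 2) ^ Suc j \<le> norm z"
        unfolding j_def by (rule LeastI)
      have zl: "norm z < (1 / 2) ^ j"
      proof (cases j)
        case (Suc k)
        then show ?thesis
          using not_less_Least[of k "\<lambda>j. (1 / 2) ^ Suc j \<le> norm z"] unfolding j_def[symmetric] by simp
      qed (use 3 in simp)
      have "((1 / 2) ^ Suc j) powr a \<le> norm z powr a"
        using \<open>a > 0\<close> j by (intro powr_mono2) auto
      moreover have "(2 powr a) ^ Suc j = 1 / ((1 / 2) ^ Suc j) powr a"
      proof -
        have "(2 powr a) ^ Suc j = (2 ^ Suc j) powr a"
          by (simp add: powr_power powr_powr mult.commute del: power_Suc of_nat_Suc flip: powr_realpow)
        then show ?thesis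
          by (simp add: power_one_over powr_divide del: power_Suc)
      qed
      moreover have "min 1 ((norm z)\<^sup>2) \<le> (1 / 4) ^ j"
      proof -
        have "(norm z)\<^sup>2 \<le> ((1 / 2) ^ j)\<^sup>2"
          using zl by (intro power_mono) auto
        also have "\<dots> = (1 / 4) ^ j"
          by (simp add: power2_eq_square flip: power_mult_distrib)
        finally show ?thesis by simp
      qed
      ultimately have "min 1 ((norm z)\<^sup>2) / norm z powr a \<le> (1 / 4) ^ j / ((1 / 2) ^ Suc j) powr a"
        by (intro frac_le) auto
      also have "\<dots> = c2 j"
        using \<open>(2 powr a) ^ Suc j = _\<close> by (simp only: c2_def) simp
      finally have "ennreal (min 1 ((norm z)\<^sup>2) / norm z powr a) \<le> ennreal (c2 j) * indicator (ball 0 (r2 j)) z"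
        using zl by (simp add: r2_def ennreal_leI)
      also have "\<dots> \<le> (\<Sum>j. ennreal (c2 j) * indicator (ball 0 (r2 j)) z)"
        by (rule le_suminf_ennreal)
      finally show ?thesis
        by (rule order_trans) simp
    qed
  qed
  have "kernel_const TYPE('a) s
      \<le> (\<integral>\<^sup>+ (z::'a). (\<Sum>j. ennreal (c1 j) * indicator (ball 0 (r1 j)) z)
          + (\<Sum>j. ennreal (c2 j) * indicator (ball 0 (r2 j)) z) \<partial>lborel)"
    unfolding kernel_const_def a_def[symmetric] by (rule nn_integral_mono) (rule bound)
  also have "\<dots> = (\<integral>\<^sup>+ (z::'a). (\<Sum>j. ennreal (c1 j) * indicator (ball 0 (r1 j)) z) \<partial>lborel)
      + (\<integral>\<^sup>+ (z::'a). (\<Sum>j. ennreal (c2 j) * indicator (ball 0 (r2 j)) z) \<partial>lborel)"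
    by (rule nn_integral_add)
       (auto intro!: borel_measurable_suminf_order borel_measurable_times_ennreal borel_measurable_indicator)
  also have "\<dots> < \<infinity>"
    using nn_integral_sum_balls_finite[OF _ _ s1] nn_integral_sum_balls_finite[OF _ _ s2]
    by (simp add: c1_def c2_def r1_def r2_def)
  finally show ?thesis .
qed

lemma nn_integral_lborel_affine:
  fixes f :: "'a::euclidean_space \<Rightarrow> ennreal"
  assumes "f \<in> borel_measurable borel" "c \<noteq> 0"
  shows "(\<integral>\<^sup>+ y. f y \<partial>lborel) = (\<integral>\<^sup>+ z. ennreal (\<bar>c\<bar> ^ DIM('a)) * f (t + c *\<^sub>R z) \<partial>lborel)"
  using assms by (subst lborel_affine[of c t]) (simp_all add: nn_integral_density nn_integral_distr)

text \<open>Substitute y = x + \<rho> z: the Jacobian \<rho>^n against \<rho>^(-n-2s) from the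
  kernel leaves \<rho>^(-2s).\<close>

lemma nn_integral_kernel_scaled:
  fixes x :: "'a::euclidean_space"
  assumes "0 < \<rho>"
  shows "(\<integral>\<^sup>+ y. ennreal (min 1 ((norm (x - y) / \<rho>)\<^sup>2) / norm (x - y) powr (real DIM('a) + 2 * s)) \<partial>lborel)
    = ennreal (1 / \<rho> powr (2 * s)) * kernel_const TYPE('a) s"
proof -
  let ?a = "real DIM('a) + 2 * s"
  have eq: "ennreal (\<bar>\<rho>\<bar> ^ DIM('a)) * ennreal (min 1 ((norm (x - (x + \<rho> *\<^sub>R z)) / \<rho>)\<^sup>2) / norm (x - (x + \<rho> *\<^sub>R z)) powr ?a)
      = ennreal (1 / \<rho> powr (2 * s)) * ennreal (min 1 ((norm z)\<^sup>2) / norm z powr ?a)" for z :: 'a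
  proof -
    have "\<rho> powr ?a = \<rho> ^ DIM('a) * \<rho> powr (2 * s)"
      using assms by (simp add: powr_add powr_realpow)
    then have "\<bar>\<rho>\<bar> ^ DIM('a) * (min 1 ((norm (x - (x + \<rho> *\<^sub>R z)) / \<rho>)\<^sup>2) / norm (x - (x + \<rho> *\<^sub>R z)) powr ?a)
        = 1 / \<rho> powr (2 * s) * (min 1 ((norm z)\<^sup>2) / norm z powr ?a)"
      using assms by (simp add: powr_mult)
    then show ?thesis
      using assms by (simp flip: ennreal_mult)
  qed
  show ?thesis
    unfolding kernel_const_def
    by (subst nn_integral_lborel_affine[of _ \<rho> x])
       (use assms in \<open>auto simp only: eq intro!: nn_integral_cmult\<close>, auto)
qed

subsection \<open>Neighbourhoods of Lipschitz boundaries\<close>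

lemma emeasure_lborel_translate:
  fixes T :: "'a::euclidean_space set"
  assumes "T \<in> sets borel"
  shows "(+) c ` T \<in> sets borel" "emeasure lborel ((+) c ` T) = emeasure lborel T"
proof -
  have eq: "(+) c ` T = (\<lambda>x. - c + x) -` T"
  proof (intro set_eqI iffI)
    fix x assume "x \<in> (\<lambda>x. - c + x) -` T"
    then show "x \<in> (+) c ` T"
      by (intro image_eqI[of _ _ "- c + x"]) auto
  qed auto
  then show "(+) c ` T \<in> sets borel"
    using measurable_sets[of "\<lambda>x. - c + x" borel borel T] assms by simp
  show "emeasure lborel ((+) c ` T) = emeasure lborel T"
    unfolding eq using assms
    by (subst (2) lborel_distr_plus[of "- c", symmetric]) (simp add: emeasure_distr)
qed

text \<open>
  Fubini is avoided: the translates of the tube by multiples of \<open>2 * h *\<^sub>R e\<close> are disjoint, and about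
  \<open>R / (2 * h)\<close> of them fit into the ball of twice the radius.
\<close>

lemma emeasure_graph_tube_le:
  fixes F :: "'a::euclidean_space \<Rightarrow> real"
  assumes F: "continuous_on UNIV F" and shift: "\<And>x t. F (x + t *\<^sub>R e) = F x + t" and e: "norm e = 1"
    and "0 < h" "0 < R"
  shows "emeasure lborel {x \<in> ball p R. \<bar>F x\<bar> < h} \<le> ennreal (2 * h / R) * emeasure lborel (ball p (2 * R))"
proof -
  define T where "T = {x \<in> ball p R. \<bar>F x\<bar> < h}"
  \<comment> \<open>Shifts with \<open>j \<le> m\<close> have length at most \<open>R\<close>, so
    the translates stay in the double ball. Counting \<open>j = 0\<close> there are
    \<open>Suc m\<close> of them, which is at least \<open>R / (2 * h)\<close>.\<close>
  define m where "m = nat \<lfloor>R / (2 * h)\<rfloor>"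
  have m: "real m \<le> R / (2 * h)" "R / (2 * h) \<le> real (Suc m)"
    using \<open>0 < h\<close> \<open>0 < R\<close> by (simp_all add: m_def) linarith
  have [measurable]: "F \<in> borel_measurable borel"
    by (rule borel_measurable_continuous_onI[OF F])
  have T[measurable]: "T \<in> sets borel"
    unfolding T_def by measurable
  define W where "W j = (+) ((2 * h * real j) *\<^sub>R e) ` T" for j :: nat
  have W: "W j \<in> sets borel" "emeasure lborel (W j) = emeasure lborel T" for j
    unfolding W_def using emeasure_lborel_translate[OF T] by auto
  \<comment> \<open>\<open>F\<close> grows at unit speed along \<open>e\<close>, so each translate
    lies in its own slab of values of \<open>F\<close>, and these slabs do not overlap.\<close>
  have FW: "2 * h * real j - h < F y" "F y < 2 * h * real j + h" if "y \<in> W j" for y j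
    using that by (auto simp: W_def T_def add.commute[of "_ *\<^sub>R e"] shift)
  have "disjoint_family_on W {..m}"
    unfolding disjoint_family_on_def
  proof (intro ballI impI)
    have *: "W i \<inter> W j = {}" if "i < j" for i j
    proof (rule ccontr)
      assume "W i \<inter> W j \<noteq> {}"
      then obtain y where "y \<in> W i" "y \<in> W j" by blast
      then have "2 * h * real j - h < 2 * h * real i + h"
        using FW by (meson order.strict_trans)
      then have "2 * h * real j < 2 * h * (real i + 1)"
        by (simp add: algebra_simps)
      with \<open>0 < h\<close> that show False by simp
    qed
    show "W i \<inter> W j = {}" if "i \<noteq> j" for i j
      using *[of i j] *[of j i] that by (cases i j rule: linorder_cases) auto
  qed
  then have "(\<Sum>j\<le>m. emeasure lborel (W j)) = emeasure lborel (\<Union>j\<le>m. W j)"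
    using W(1) by (intro sum_emeasure) auto
  also have "\<dots> \<le> emeasure lborel (ball p (2 * R))"
  proof (rule emeasure_mono)
    show "(\<Union>j\<le>m. W j) \<subseteq> ball p (2 * R)"
    proof (intro UN_least)
      fix j assume "j \<in> {..m}"
      then have "2 * h * real j \<le> 2 * h * real m"
        using \<open>0 < h\<close> by simp
      also have "\<dots> \<le> R"
        using m(1) \<open>0 < h\<close> by (simp add: field_simps)
      finally have j: "norm ((2 * h * real j) *\<^sub>R e) \<le> R"
        using e \<open>0 < h\<close> by simp
      show "W j \<subseteq> ball p (2 * R)"
      proof
        fix y assume "y \<in> W j"
        then obtain x where x: "x \<in> ball p R" "y = (2 * h * real j) *\<^sub>R e + x"
          by (auto simp: W_def T_def)
        then have "dist p y \<le> dist p x + norm ((2 * h * real j) *\<^sub>R e)"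
          by (metis add.commute add_diff_cancel_left' dist_commute dist_norm dist_triangle)
        with x j show "y \<in> ball p (2 * R)" by simp
      qed
    qed
  qed simp
  finally have le: "of_nat (Suc m) * emeasure lborel T \<le> emeasure lborel (ball p (2 * R))"
    by (simp add: W)
  have "emeasure lborel T = ennreal (2 * h / R) * (ennreal (R / (2 * h)) * emeasure lborel T)"
    using \<open>0 < h\<close> \<open>0 < R\<close> by (simp flip: mult.assoc ennreal_mult)
  also have "\<dots> \<le> ennreal (2 * h / R) * (of_nat (Suc m) * emeasure lborel T)"
    using m(2) by (intro mult_left_mono mult_right_mono) (auto simp: ennreal_of_nat_eq_real_of_nat intro: ennreal_leI simp del: of_nat_Suc)
  also have "\<dots> \<le> ennreal (2 * h / R) * emeasure lborel (ball p (2 * R))"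
    by (intro mult_left_mono le) simp
  finally show ?thesis by (simp add: T_def)
qed

text \<open>The height \<open>F\<close> above the graph is Lipschitz on the whole space and vanishes
  on the boundary near \<open>p\<close>, so a point within \<open>h\<close> of the boundary has
  height of order \<open>h\<close> and \<open>emeasure_graph_tube_le\<close> applies.\<close>

lemma lipschitz_frontier_local_tube:
  fixes S :: "'a::euclidean_space set"
  assumes "lipschitz_set S" "p \<in> frontier S"
  shows "\<exists>\<rho>>0. \<exists>C\<ge>0. \<forall>h. 0 < h \<and> h < \<rho> \<longrightarrow>
    emeasure lborel (\<Union>z\<in>frontier S \<inter> ball p \<rho>. ball z h) \<le> ennreal (C * h)"
proof -
  obtain V e g L where V: "open V" "p \<in> V" "norm e = 1" "L-lipschitz_on {y. y \<bullet> e = 0} g"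
    "frontier S \<inter> V = {x\<in>V. x \<bullet> e = g (x - (x \<bullet> e) *\<^sub>R e)}"
    using assms unfolding lipschitz_set_def by blast
  obtain R where R: "R > 0" "ball p R \<subseteq> V"
    using V(1,2) openE by blast
  \<comment> \<open>With half the radius, balls of radius \<open>h < \<rho>\<close> around boundary
    points in \<open>ball p \<rho>\<close> stay inside \<open>ball p R\<close>.\<close>
  define \<rho> where "\<rho> = R / 2"
  have "\<rho> > 0" using R by (simp add: \<rho>_def)
  define P where "P x = x - (x \<bullet> e) *\<^sub>R e" for x
  define F where "F x = x \<bullet> e - g (P x)" for x
  have ee: "e \<bullet> e = 1" using V(3) by (simp add: dot_square_norm)
  have Pe: "P x \<bullet> e = 0" for x
    by (simp add: P_def inner_diff_left ee)
  have L: "0 \<le> L" by (rule lipschitz_on_nonneg[OF V(4)])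
  have ie: "\<bar>(x - y) \<bullet> e\<bar> \<le> dist x y" for x y
    using Cauchy_Schwarz_ineq2[of "x - y" e] V(3) by (simp add: dist_norm)
  \<comment> \<open>The coordinate along \<open>e\<close> contributes 1; the projection is crudely
    2-Lipschitz by the triangle inequality, so \<open>g\<close> contributes
    \<open>2 * L\<close>.\<close>
  have lipF: "\<bar>F x - F y\<bar> \<le> (1 + 2 * L) * dist x y" for x y
  proof -
    have "dist (P x) (P y) = norm ((x - y) - ((x - y) \<bullet> e) *\<^sub>R e)"
      by (simp add: P_def dist_norm inner_diff_left algebra_simps)
    also have "\<dots> \<le> norm (x - y) + \<bar>(x - y) \<bullet> e\<bar>"
      using norm_triangle_ineq4[of "x - y" "((x - y) \<bullet> e) *\<^sub>R e"] V(3) by simp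
    also have "\<dots> \<le> 2 * dist x y"
      using ie[of x y] by (simp add: dist_norm)
    finally have "L * dist (P x) (P y) \<le> L * (2 * dist x y)"
      using L by (rule mult_left_mono)
    moreover have "\<bar>g (P x) - g (P y)\<bar> \<le> L * dist (P x) (P y)"
      using lipschitz_onD[OF V(4), of "P x" "P y"] Pe by (simp add: dist_real_def)
    moreover have "F x - F y = (x - y) \<bullet> e - (g (P x) - g (P y))"
      by (simp add: F_def inner_diff_left)
    ultimately show ?thesis
      using ie[of x y] by (simp add: algebra_simps)
  qed
  have contF: "continuous_on UNIV F"
    using L lipF by (intro lipschitz_on_continuous_on[of "1 + 2 * L"] lipschitz_onI) (auto simp: dist_real_def)
  have shift: "F (x + t *\<^sub>R e) = F x + t" for x t
  proof -
    have "P (x + t *\<^sub>R e) = P x"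
      by (simp add: P_def inner_add_left ee algebra_simps)
    then show ?thesis by (simp add: F_def inner_add_left ee)
  qed
  define C where "C = 2 * (1 + 2 * L) / R * (unit_ball_vol (real DIM('a)) * (2 * R) ^ DIM('a))"
  have "emeasure lborel (\<Union>z\<in>frontier S \<inter> ball p \<rho>. ball z h) \<le> ennreal (C * h)"
    if h: "0 < h" "h < \<rho>" for h
  proof -
    have [measurable]: "F \<in> borel_measurable borel"
      by (rule borel_measurable_continuous_onI[OF contF])
    have H: "0 < (1 + 2 * L) * h" using L h by simp
    have "(\<Union>z\<in>frontier S \<inter> ball p \<rho>. ball z h) \<subseteq> {x \<in> ball p R. \<bar>F x\<bar> < (1 + 2 * L) * h}"
    proof safe
      fix z x assume z: "z \<in> frontier S" "z \<in> ball p \<rho>" and x: "x \<in> ball z h"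
      have "dist p x < R"
        using z x h dist_triangle[of p x z] by (simp add: \<rho>_def)
      then show "x \<in> ball p R" by simp
      have "z \<in> V" using z R by (auto simp: \<rho>_def)
      then have "F z = 0"
        using z V(5) by (auto simp: F_def P_def)
      then have "\<bar>F x\<bar> \<le> (1 + 2 * L) * dist z x"
        using lipF[of x z] by (simp add: dist_commute)
      also have "\<dots> < (1 + 2 * L) * h"
        using L x by simp
      finally show "\<bar>F x\<bar> < (1 + 2 * L) * h" .
    qed
    then have "emeasure lborel (\<Union>z\<in>frontier S \<inter> ball p \<rho>. ball z h)
        \<le> emeasure lborel {x \<in> ball p R. \<bar>F x\<bar> < (1 + 2 * L) * h}"
      by (rule emeasure_mono) simp
    also have "\<dots> \<le> ennreal (2 * ((1 + 2 * L) * h) / R) * emeasure lborel (ball p (2 * R))"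
      by (rule emeasure_graph_tube_le[OF contF shift V(3) H R(1)])
    also have "\<dots> = ennreal (2 * ((1 + 2 * L) * h) / R) * ennreal (unit_ball_vol (real DIM('a)) * (2 * R) ^ DIM('a))"
      using R(1) by (simp add: emeasure_ball)
    also have "\<dots> = ennreal (C * h)"
      using L h(1) R(1) by (subst ennreal_mult[symmetric]) (auto simp: C_def mult_ac unit_ball_vol_nonneg)
    finally show ?thesis .
  qed
  moreover have "C \<ge> 0" using L R by (simp add: C_def)
  ultimately show ?thesis using \<open>\<rho> > 0\<close> by blast
qed

text \<open>Cover \<open>K\<close> by finitely many balls with a local tube estimate, add the
  constants and take the least radius.\<close>

lemma lipschitz_frontier_tube:
  fixes S :: "'a::euclidean_space set"
  assumes S: "lipschitz_set S" and K: "compact K" "K \<subseteq> frontier S"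
  shows "\<exists>\<rho>>0. \<exists>C\<ge>0. \<forall>h. 0 < h \<and> h < \<rho> \<longrightarrow> emeasure lborel (\<Union>z\<in>K. ball z h) \<le> ennreal (C * h)"
proof -
  obtain \<rho> C where \<rho>: "\<And>p. p \<in> K \<Longrightarrow> \<rho> p > 0" and C: "\<And>p. p \<in> K \<Longrightarrow> C p \<ge> 0"
    and bound: "\<And>p h. p \<in> K \<Longrightarrow> 0 < h \<Longrightarrow> h < \<rho> p \<Longrightarrow>
      emeasure lborel (\<Union>z\<in>frontier S \<inter> ball p (\<rho> p). ball z h) \<le> ennreal (C p * h)"
    using lipschitz_frontier_local_tube[OF S] K(2) by (metis subsetD)
  obtain D where D: "D \<subseteq> K" "finite D" "K \<subseteq> (\<Union>p\<in>D. ball p (\<rho> p))"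
    by (rule compactE_image[OF K(1), of K "\<lambda>p. ball p (\<rho> p)"]) (use \<rho> in force)+
  \<comment> \<open>Inserting 1 keeps the minimum meaningful when the finite cover is empty.\<close>
  define r where "r = Min (insert 1 (\<rho> ` D))"
  have "r > 0" and r: "\<And>p. p \<in> D \<Longrightarrow> r \<le> \<rho> p"
    using D \<rho> by (auto simp: r_def)
  have "emeasure lborel (\<Union>z\<in>K. ball z h) \<le> ennreal ((\<Sum>p\<in>D. C p) * h)" if h: "0 < h" "h < r" for h
  proof -
    have "emeasure lborel (\<Union>z\<in>K. ball z h)
        \<le> emeasure lborel (\<Union>p\<in>D. \<Union>z\<in>frontier S \<inter> ball p (\<rho> p). ball z h)"
    proof (rule emeasure_mono)
      show "(\<Union>z\<in>K. ball z h) \<subseteq> (\<Union>p\<in>D. \<Union>z\<in>frontier S \<inter> ball p (\<rho> p). ball z h)"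
        using D(3) K(2) by blast
    qed (auto intro!: borel_open open_UN)
    also have "\<dots> \<le> (\<Sum>p\<in>D. emeasure lborel (\<Union>z\<in>frontier S \<inter> ball p (\<rho> p). ball z h))"
      using D(2) by (intro emeasure_subadditive_finite) (auto intro!: borel_open open_UN)
    also have "\<dots> \<le> (\<Sum>p\<in>D. ennreal (C p * h))"
    proof (rule sum_mono)
      fix p assume "p \<in> D"
      with D(1) h r[of p] show "emeasure lborel (\<Union>z\<in>frontier S \<inter> ball p (\<rho> p). ball z h) \<le> ennreal (C p * h)"
        by (intro bound) auto
    qed
    also have "\<dots> = ennreal ((\<Sum>p\<in>D. C p) * h)"
      using C D(1) h by (subst sum_ennreal) (auto simp: sum_distrib_right)
    finally show ?thesis .
  qed
  moreover have "(\<Sum>p\<in>D. C p) \<ge> 0"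
    using C D(1) by (auto intro: sum_nonneg)
  ultimately show ?thesis using \<open>r > 0\<close> by blast
qed

subsection \<open>Energy of the cutoff\<close>

lemma nn_integral_lebesgue_on_borel:
  fixes S :: "'a::euclidean_space set"
  assumes "S \<in> sets borel"
  shows "(\<integral>\<^sup>+ x. f x \<partial>lebesgue_on S) = (\<integral>\<^sup>+ x. f x * indicator S x \<partial>lborel)"
  using assms by (simp add: nn_integral_restrict_space nn_integral_completion)

text \<open>Each summand of the pointwise bound has a length scale depending on one point only, so
  integrating out the other point over the whole space gives the scaled kernel integral. Tonelli
  identifies the two summands, whence the factor 2.\<close>

lemma gagliardo_integral_le_kernel:
  fixes u :: "'a::euclidean_space \<Rightarrow> real"
  assumes [measurable]: "S \<in> sets borel" "A \<in> sets borel" "\<rho> \<in> borel_measurable borel"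
    and \<rho>: "\<And>x. x \<in> A \<Longrightarrow> 0 < \<rho> x"
    and le: "\<And>x y. x \<in> S \<Longrightarrow> y \<in> S \<Longrightarrow> \<bar>u x - u y\<bar>\<^sup>2 \<le>
      indicator A x * min 1 ((norm (x - y) / \<rho> x)\<^sup>2) + indicator A y * min 1 ((norm (x - y) / \<rho> y)\<^sup>2)"
  shows "gagliardo_integral s S u \<le>
    2 * kernel_const TYPE('a) s * (\<integral>\<^sup>+ x. ennreal (1 / \<rho> x powr (2 * s)) * indicator A x \<partial>lborel)"
proof -
  define a where "a = real DIM('a) + 2 * s"
  define K where "K x y = ennreal (min 1 ((norm (x - y) / \<rho> x)\<^sup>2) / norm (x - y) powr a) * indicator A x" for x y :: 'a
  have [measurable]: "case_prod K \<in> borel_measurable (borel \<Otimes>\<^sub>M borel)"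
    unfolding K_def by measurable
  have KL: "case_prod K \<in> borel_measurable (lborel \<Otimes>\<^sub>M lborel)"
    by measurable
  have KL': "case_prod (\<lambda>x y. K y x) \<in> borel_measurable (lborel \<Otimes>\<^sub>M lborel)"
    unfolding K_def by measurable
  have K1: "K x \<in> borel_measurable lborel" and K2: "(\<lambda>y. K y x) \<in> borel_measurable lborel" for x
    unfolding K_def by measurable
  have pw: "ennreal (\<bar>u x - u y\<bar>\<^sup>2 / norm (x - y) powr a) * indicator S y * indicator S x \<le> K x y + K y x" for x y
  proof (cases "x \<in> S \<and> y \<in> S")
    case True
    then have "\<bar>u x - u y\<bar>\<^sup>2 / norm (x - y) powr a
        \<le> (indicator A x * min 1 ((norm (x - y) / \<rho> x)\<^sup>2) + indicator A y * min 1 ((norm (x - y) / \<rho> y)\<^sup>2)) / norm (x - y) powr a"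
      by (intro divide_right_mono le) auto
    also have "\<dots> = indicator A x * (min 1 ((norm (x - y) / \<rho> x)\<^sup>2) / norm (x - y) powr a)
        + indicator A y * (min 1 ((norm (x - y) / \<rho> y)\<^sup>2) / norm (x - y) powr a)"
      by (simp add: add_divide_distrib)
    finally have "ennreal (\<bar>u x - u y\<bar>\<^sup>2 / norm (x - y) powr a)
        \<le> ennreal (indicator A x * (min 1 ((norm (x - y) / \<rho> x)\<^sup>2) / norm (x - y) powr a)
        + indicator A y * (min 1 ((norm (x - y) / \<rho> y)\<^sup>2) / norm (x - y) powr a))"
      by (rule ennreal_leI)
    also have "\<dots> = K x y + K y x"
      by (subst ennreal_plus) (auto simp: K_def indicator_def norm_minus_commute)
    finally show ?thesis using True by simp
  qed auto
  have Kint: "(\<integral>\<^sup>+ y. K x y \<partial>lborel) = kernel_const TYPE('a) s * (ennreal (1 / \<rho> x powr (2 * s)) * indicator A x)" for x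
  proof (cases "x \<in> A")
    case True
    then show ?thesis
      using nn_integral_kernel_scaled[OF \<rho>[OF True], of x s] by (simp add: K_def a_def mult.commute)
  qed (simp add: K_def)
  let ?J = "\<integral>\<^sup>+ x. ennreal (1 / \<rho> x powr (2 * s)) * indicator A x \<partial>lborel"
  have 1: "(\<integral>\<^sup>+ x. (\<integral>\<^sup>+ y. K x y \<partial>lborel) \<partial>lborel) = kernel_const TYPE('a) s * ?J"
    unfolding Kint by (rule nn_integral_cmult) measurable
  have 2: "(\<integral>\<^sup>+ x. (\<integral>\<^sup>+ y. K y x \<partial>lborel) \<partial>lborel) = (\<integral>\<^sup>+ x. (\<integral>\<^sup>+ y. K x y \<partial>lborel) \<partial>lborel)"
    by (rule lborel_pair.Fubini'[OF KL])
  have "gagliardo_integral s S u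
      = (\<integral>\<^sup>+ x. (\<integral>\<^sup>+ y. ennreal (\<bar>u x - u y\<bar>\<^sup>2 / norm (x - y) powr a) * indicator S y \<partial>lborel) * indicator S x \<partial>lborel)"
    by (simp add: gagliardo_integral_def a_def nn_integral_lebesgue_on_borel)
  also have "\<dots> = (\<integral>\<^sup>+ x. (\<integral>\<^sup>+ y. ennreal (\<bar>u x - u y\<bar>\<^sup>2 / norm (x - y) powr a) * indicator S y * indicator S x \<partial>lborel) \<partial>lborel)"
    by (intro nn_integral_cong) (auto simp: indicator_def)
  also have "\<dots> \<le> (\<integral>\<^sup>+ x. (\<integral>\<^sup>+ y. K x y + K y x \<partial>lborel) \<partial>lborel)"
    by (intro nn_integral_mono pw)
  also have "\<dots> = (\<integral>\<^sup>+ x. (\<integral>\<^sup>+ y. K x y \<partial>lborel) + (\<integral>\<^sup>+ y. K y x \<partial>lborel) \<partial>lborel)"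
    by (intro nn_integral_cong nn_integral_add K1 K2)
  also have "\<dots> = (\<integral>\<^sup>+ x. (\<integral>\<^sup>+ y. K x y \<partial>lborel) \<partial>lborel) + (\<integral>\<^sup>+ x. (\<integral>\<^sup>+ y. K y x \<partial>lborel) \<partial>lborel)"
    by (rule nn_integral_add[OF lborel.borel_measurable_nn_integral[OF KL] lborel.borel_measurable_nn_integral[OF KL']])
  also have "\<dots> = 2 * kernel_const TYPE('a) s * ?J"
    by (simp only: 2 1 mult_2 distrib_right)
  finally show ?thesis .
qed

lemma infdist_pos_open:
  assumes "open W" "- W \<noteq> {}" "x \<in> W"
  shows "0 < infdist x (- W)"
  using assms infdist_pos_not_in_closed[of "- W" x] by auto

text \<open>Apply the kernel bound with a variable length scale. The first term collects all points
  whose scale is comparable to the distance to the complement of \<open>W\<close>, the second the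
  layer points near the boundary of \<open>\<Omega>\<close>.\<close>

lemma gagliardo_integral_cutoff_le:
  fixes \<phi> :: "'a::euclidean_space \<Rightarrow> real"
  assumes s: "0 < s" "s < 1 / 2" and op: "open \<Omega>" "open W" and W: "- W \<noteq> {}" and "0 < \<delta>"
    and A: "A = W \<inter> \<Omega>"
    and \<phi>: "\<And>x. 0 \<le> \<phi> x" "\<And>x. \<phi> x \<le> 1" "(1 / \<delta>)-lipschitz_on UNIV \<phi>"
      "\<And>x. 3 * \<delta> \<le> infdist x (- A) \<Longrightarrow> \<phi> x = 1" "\<And>x. x \<notin> A \<Longrightarrow> \<phi> x = 0"
  shows "gagliardo_integral s \<Omega> \<phi> \<le> 2 * kernel_const TYPE('a) s *
    (3 * (\<integral>\<^sup>+ x. ennreal (1 / infdist x (- W) powr (2 * s)) * indicator A x \<partial>lborel)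
      + ennreal (1 / \<delta> powr (2 * s)) * emeasure lborel (A \<inter> (\<Union>z\<in>frontier \<Omega>. ball z (3 * \<delta>))))"
proof -
  \<comment> \<open>A core point is charged only for points of \<open>\<Omega>\<close> outside
    \<open>A\<close>, hence outside \<open>W\<close>, at distance at least
    \<open>infdist x (- W)\<close>; a layer point uses the Lipschitz scale
    \<open>\<delta>\<close>.\<close>
  define \<rho> where "\<rho> x = (if 3 * \<delta> \<le> infdist x (- A) then infdist x (- W) else \<delta>)" for x
  define N where "N = A \<inter> (\<Union>z\<in>frontier \<Omega>. ball z (3 * \<delta>))"
  have [measurable]: "A \<in> sets borel" "\<Omega> \<in> sets borel" "N \<in> sets borel"
    using op by (auto simp: A N_def intro!: borel_open)
  have [measurable]: "(\<lambda>x. infdist x B) \<in> borel_measurable borel" for B :: "'a set"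
    by (intro borel_measurable_continuous_onI continuous_intros)
  have [measurable]: "\<rho> \<in> borel_measurable borel"
    unfolding \<rho>_def by measurable
  have mono: "infdist x (- A) \<le> infdist x (- W)" for x
    using W by (intro infdist_mono) (auto simp: A)
  have dW: "0 < infdist x (- W)" if "x \<in> A" for x
    using infdist_pos_open[OF op(2) W] that by (simp add: A)
  have \<rho>: "0 < \<rho> x" if "x \<in> A" for x
    using dW[OF that] \<open>0 < \<delta>\<close> by (simp add: \<rho>_def)
  have diff1: "\<bar>\<phi> x - \<phi> y\<bar> \<le> 1" for x y
    using \<phi>(1,2)[of x] \<phi>(1,2)[of y] by linarith
  then have diff2: "\<bar>\<phi> x - \<phi> y\<bar>\<^sup>2 \<le> 1" for x y
    by (intro power_le_one) auto
  have key: "\<bar>\<phi> x - \<phi> y\<bar>\<^sup>2 \<le> min 1 ((norm (x - y) / \<rho> x)\<^sup>2)"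
    if "x \<in> A" "y \<in> \<Omega>" "infdist x (- A) < 3 * \<delta> \<or> y \<notin> A" for x y
  proof (cases "infdist x (- A) < 3 * \<delta>")
    case True
    have "\<bar>\<phi> x - \<phi> y\<bar> \<le> norm (x - y) / \<delta>"
      using lipschitz_onD[OF \<phi>(3), of x y] by (simp add: dist_norm)
    then have "\<bar>\<phi> x - \<phi> y\<bar>\<^sup>2 \<le> (norm (x - y) / \<delta>)\<^sup>2"
      by (intro power_mono) auto
    with True diff2 show ?thesis by (simp add: \<rho>_def)
  next
    case False
    then have "y \<notin> W" using that by (auto simp: A)
    then have "infdist x (- W) \<le> norm (x - y)"
      using infdist_le[of y "- W" x] by (simp add: dist_norm)
    then have "1 \<le> norm (x - y) / \<rho> x"
      using False dW[OF \<open>x \<in> A\<close>] by (simp add: \<rho>_def)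
    then have "1 \<le> (norm (x - y) / \<rho> x)\<^sup>2"
      by (rule one_le_power)
    with diff2 show ?thesis by simp
  qed
  have kern: "\<bar>\<phi> x - \<phi> y\<bar>\<^sup>2 \<le>
      indicator A x * min 1 ((norm (x - y) / \<rho> x)\<^sup>2) + indicator A y * min 1 ((norm (x - y) / \<rho> y)\<^sup>2)"
    if "x \<in> \<Omega>" "y \<in> \<Omega>" for x y
  proof -
    have nn: "0 \<le> indicator A x * min 1 ((norm (x - y) / \<rho> x)\<^sup>2)"
      "0 \<le> indicator A y * min 1 ((norm (x - y) / \<rho> y)\<^sup>2)"
      by (auto simp: indicator_def)
    \<comment> \<open>If neither point can be charged, both are in the core, where the cutoff is 1,
      or both are outside \<open>A\<close>, where it is 0.\<close>
    consider "x \<in> A" "infdist x (- A) < 3 * \<delta> \<or> y \<notin> A" | "y \<in> A" "infdist y (- A) < 3 * \<delta> \<or> x \<notin> A"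
      | "\<phi> x = \<phi> y"
      using \<phi>(4)[of x] \<phi>(4)[of y] \<phi>(5)[of x] \<phi>(5)[of y] by fastforce
    then show ?thesis
    proof cases
      case 1
      have "\<bar>\<phi> x - \<phi> y\<bar>\<^sup>2 \<le> indicator A x * min 1 ((norm (x - y) / \<rho> x)\<^sup>2)"
        using key[OF 1(1) \<open>y \<in> \<Omega>\<close> 1(2)] 1(1) by simp
      with nn show ?thesis by linarith
    next
      case 2
      have "\<bar>\<phi> x - \<phi> y\<bar>\<^sup>2 \<le> indicator A y * min 1 ((norm (x - y) / \<rho> y)\<^sup>2)"
        using key[OF 2(1) \<open>x \<in> \<Omega>\<close> 2(2)] 2(1)
        by (simp add: norm_minus_commute power2_commute)
      with nn show ?thesis by linarith
    next
      case 3
      with nn show ?thesis by simp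
    qed
  qed
  have pw: "ennreal (1 / \<rho> x powr (2 * s)) * indicator A x
      \<le> 3 * (ennreal (1 / infdist x (- W) powr (2 * s)) * indicator A x) + ennreal (1 / \<delta> powr (2 * s)) * indicator N x" for x
  proof (cases "x \<in> A")
    case True
    \<comment> \<open>The factor 3 arises from 3^(2s) \<le> 3, as 2s < 1.\<close>
    have le3: "ennreal (1 / \<rho> x powr (2 * s)) \<le> 3 * ennreal (1 / infdist x (- W) powr (2 * s))"
      if "infdist x (- W) \<le> 3 * \<rho> x"
    proof -
      have "infdist x (- W) powr (2 * s) \<le> (3 * \<rho> x) powr (2 * s)"
        using that s dW[OF True] by (intro powr_mono2) auto
      also have "\<dots> = 3 powr (2 * s) * \<rho> x powr (2 * s)"
        using \<rho>[OF True] by (simp add: powr_mult)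
      also have "\<dots> \<le> 3 * \<rho> x powr (2 * s)"
        using s powr_mono[of "2 * s" 1 3] by (intro mult_right_mono) auto
      finally have "1 / \<rho> x powr (2 * s) \<le> 3 * (1 / infdist x (- W) powr (2 * s))"
        using dW[OF True] \<rho>[OF True] by (simp add: field_simps)
      then have "ennreal (1 / \<rho> x powr (2 * s)) \<le> ennreal (3 * (1 / infdist x (- W) powr (2 * s)))"
        by (rule ennreal_leI)
      then show ?thesis
        by (subst (asm) ennreal_mult) auto
    qed
    show ?thesis
    proof (cases "3 * \<delta> \<le> infdist x (- A)")
      case far: True
      then have "infdist x (- W) \<le> 3 * \<rho> x"
        using dW[OF True] by (simp add: \<rho>_def)
      from le3[OF this] True show ?thesis
        by (simp add: add_increasing2)
    next
      case near: False
      have "\<exists>y\<in>- A. dist x y < 3 * \<delta>"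
      proof (rule ccontr)
        assume "\<not> ?thesis"
        moreover have "- A \<noteq> {}" using W by (auto simp: A)
        ultimately have "3 * \<delta> \<le> infdist x (- A)"
          unfolding infdist_def by (simp add: not_less) (rule cINF_greatest, auto)
        with near show False by simp
      qed
      then obtain y where y: "y \<notin> A" "dist x y < 3 * \<delta>" by auto
      show ?thesis
      \<comment> \<open>A nearby point \<open>y\<close> outside \<open>A\<close> misses
        \<open>W\<close> or \<open>\<Omega>\<close>. In the first case the distance to the
        complement of \<open>W\<close> is below \<open>3 * \<delta>\<close>; in the second the
        segment from \<open>x\<close> to \<open>y\<close> crosses the boundary of
        \<open>\<Omega>\<close> within \<open>3 * \<delta>\<close> of \<open>x\<close>.\<close>
      proof (cases "y \<in> W")
        case False
        then have "infdist x (- W) \<le> 3 * \<rho> x"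
          using infdist_le[of y "- W" x] y near by (simp add: \<rho>_def)
        from le3[OF this] True show ?thesis
          by (simp add: add_increasing2)
      next
        case yW: True
        then have "y \<notin> \<Omega>" using y by (simp add: A)
        moreover have "x \<in> \<Omega>" using True by (simp add: A)
        ultimately have "closed_segment x y \<inter> frontier \<Omega> \<noteq> {}"
          by (intro connected_Int_frontier) auto
        then obtain z where z: "z \<in> closed_segment x y" "z \<in> frontier \<Omega>" by blast
        then have "dist z x < 3 * \<delta>"
          using y(2) dist_in_closed_segment[OF z(1)] by (simp add: dist_commute)
        then have "x \<in> N"
          using z(2) True by (auto simp: N_def)
        then show ?thesis
          using near True by (simp add: \<rho>_def add_increasing)
      qed
    qed
  qed simp
  have "(\<integral>\<^sup>+ x. ennreal (1 / \<rho> x powr (2 * s)) * indicator A x \<partial>lborel)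
      \<le> (\<integral>\<^sup>+ x. 3 * (ennreal (1 / infdist x (- W) powr (2 * s)) * indicator A x) + ennreal (1 / \<delta> powr (2 * s)) * indicator N x \<partial>lborel)"
    by (rule nn_integral_mono) (rule pw)
  also have "\<dots> = (\<integral>\<^sup>+ x. 3 * (ennreal (1 / infdist x (- W) powr (2 * s)) * indicator A x) \<partial>lborel)
      + (\<integral>\<^sup>+ x. ennreal (1 / \<delta> powr (2 * s)) * indicator N x \<partial>lborel)"
    by (rule nn_integral_add) measurable
  also have "\<dots> = 3 * (\<integral>\<^sup>+ x. ennreal (1 / infdist x (- W) powr (2 * s)) * indicator A x \<partial>lborel)
      + ennreal (1 / \<delta> powr (2 * s)) * emeasure lborel N"
    by (intro arg_cong2[where f="(+)"] nn_integral_cmult nn_integral_cmult_indicator) measurable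
  finally have "2 * kernel_const TYPE('a) s * (\<integral>\<^sup>+ x. ennreal (1 / \<rho> x powr (2 * s)) * indicator A x \<partial>lborel)
      \<le> 2 * kernel_const TYPE('a) s * \<dots>"
    by (rule mult_left_mono) simp
  moreover have "gagliardo_integral s \<Omega> \<phi> \<le> 2 * kernel_const TYPE('a) s *
      (\<integral>\<^sup>+ x. ennreal (1 / \<rho> x powr (2 * s)) * indicator A x \<partial>lborel)"
    by (rule gagliardo_integral_le_kernel) (use \<rho> kern in auto)
  ultimately show ?thesis
    unfolding N_def by (rule order_trans[rotated])
qed

section \<open>Test functions as competitors for the infimum\<close>

lemma test_functions_continuous: "\<phi> \<in> test_functions S \<Longrightarrow> continuous_on UNIV \<phi>"
  by (auto simp: test_functions_def dest: spec[of _ 0])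

lemma test_functions_eq_0: "\<phi> \<in> test_functions S \<Longrightarrow> x \<notin> S \<Longrightarrow> \<phi> x = 0"
  using closure_subset[of "{x. \<phi> x \<noteq> 0}"] by (auto simp: test_functions_def)

lemma test_functions_mono: "S \<subseteq> T \<Longrightarrow> test_functions S \<subseteq> test_functions T"
  unfolding test_functions_def by blast

lemma test_function_square_integral:
  fixes \<phi> :: "'a::euclidean_space \<Rightarrow> real"
  assumes \<phi>: "\<phi> \<in> test_functions S" and S: "S \<in> sets borel"
  shows "integrable lborel (\<lambda>x. (\<phi> x)\<^sup>2)" "integrable (lebesgue_on S) (\<lambda>x. (\<phi> x)\<^sup>2)"
    "(\<integral>x. (\<phi> x)\<^sup>2 \<partial>lebesgue_on S) = (\<integral>x. (\<phi> x)\<^sup>2 \<partial>lborel)"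
proof -
  let ?K = "closure {x. \<phi> x \<noteq> 0}"
  have [measurable]: "\<phi> \<in> borel_measurable borel"
    by (rule borel_measurable_continuous_onI[OF test_functions_continuous[OF \<phi>]])
  have "integrable lborel (\<lambda>x. indicator ?K x *\<^sub>R (\<phi> x)\<^sup>2)"
    using \<phi> by (intro borel_integrable_compact continuous_intros continuous_on_subset[OF test_functions_continuous[OF \<phi>]])
      (auto simp: test_functions_def)
  also have "(\<lambda>x. indicator ?K x *\<^sub>R (\<phi> x)\<^sup>2) = (\<lambda>x. (\<phi> x)\<^sup>2)"
    using closure_subset[of "{x. \<phi> x \<noteq> 0}"] by (auto simp: fun_eq_iff indicator_def)
  finally show int: "integrable lborel (\<lambda>x. (\<phi> x)\<^sup>2)" .
  have eq: "(\<lambda>x. indicator S x *\<^sub>R (\<phi> x)\<^sup>2) = (\<lambda>x. (\<phi> x)\<^sup>2)"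
    using test_functions_eq_0[OF \<phi>] by (auto simp: fun_eq_iff indicator_def)
  show "integrable (lebesgue_on S) (\<lambda>x. (\<phi> x)\<^sup>2)"
    using S integrable_restrict_space[of S lebesgue "\<lambda>x. (\<phi> x)\<^sup>2"] int unfolding eq
    by (simp add: integrable_completion)
  show "(\<integral>x. (\<phi> x)\<^sup>2 \<partial>lebesgue_on S) = (\<integral>x. (\<phi> x)\<^sup>2 \<partial>lborel)"
    using S integral_restrict_space[of S lebesgue "\<lambda>x. (\<phi> x)\<^sup>2"] unfolding eq
    by (simp add: integral_completion)
qed

text \<open>A test function approximates itself with zero error, so only its finite energy is at
  stake.\<close>

lemma test_function_in_frac_sobolev0:
  fixes \<phi> :: "'a::euclidean_space \<Rightarrow> real"
  assumes \<phi>: "\<phi> \<in> test_functions S" and S: "S \<in> sets borel" and G: "gagliardo_integral s S \<phi> < \<infinity>"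
  shows "\<phi> \<in> frac_sobolev0 s S"
proof -
  have "\<phi> \<in> borel_measurable borel"
    by (rule borel_measurable_continuous_onI[OF test_functions_continuous[OF \<phi>]])
  then have "\<phi> \<in> borel_measurable (lebesgue_on S)"
    by (intro measurable_restrict_space1 measurable_completion) simp
  moreover have "frac_sobolev_norm s S (\<lambda>x. \<phi> x - \<phi> x) = 0"
    by (simp add: frac_sobolev_norm_def gagliardo_seminorm_def gagliardo_integral_def)
  then have "\<forall>\<epsilon>>0. \<exists>\<psi>\<in>test_functions S. frac_sobolev_norm s S (\<lambda>x. \<phi> x - \<psi> x) < \<epsilon>"
    using \<phi> by (intro allI impI bexI[of _ \<phi>]) simp_all
  ultimately show ?thesis
    unfolding frac_sobolev0_def frac_sobolev_def
    using G test_function_square_integral(2)[OF \<phi> S] by blast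
qed

lemma poincare_const_le_test_function:
  fixes \<phi> :: "'a::euclidean_space \<Rightarrow> real"
  assumes \<phi>: "\<phi> \<in> test_functions S" and S: "S \<in> sets borel"
    and G: "gagliardo_integral s S \<phi> \<le> ennreal g" and "0 \<le> g"
    and I: "m \<le> (\<integral>x. (\<phi> x)\<^sup>2 \<partial>lborel)" and "0 < m"
  shows "poincare_const s S \<le> ennreal (\<bar>frac_const DIM('a) s\<bar> / 2 * g / m)"
proof -
  have "gagliardo_integral s S \<phi> < \<infinity>"
    using G by (rule le_less_trans) simp
  then have mem: "\<phi> \<in> frac_sobolev0 s S"
    by (rule test_function_in_frac_sobolev0[OF \<phi> S])
  have nz: "\<not> (AE x in lebesgue_on S. \<phi> x = 0)"
  proof
    assume "AE x in lebesgue_on S. \<phi> x = 0"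
    then have "(\<integral>x. (\<phi> x)\<^sup>2 \<partial>lebesgue_on S) = 0"
      by (intro integral_eq_zero_AE) auto
    then show False
      using I \<open>0 < m\<close> test_function_square_integral(3)[OF \<phi> S] by simp
  qed
  \<comment> \<open>The product of a real \<open>sqrt\<close> with itself is the absolute value of
    its argument, whatever the sign; hence the absolute value of \<open>frac_const\<close>.\<close>
  have "(gagliardo_seminorm s S \<phi>)\<^sup>2 = \<bar>frac_const DIM('a) s\<bar> / 2 * enn2real (gagliardo_integral s S \<phi>)"
    unfolding gagliardo_seminorm_def power2_eq_square real_sqrt_mult_self by (simp add: abs_mult)
  also have "\<dots> \<le> \<bar>frac_const DIM('a) s\<bar> / 2 * g"
    using enn2real_mono[OF G] \<open>0 \<le> g\<close> by (intro mult_left_mono) auto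
  finally have "(gagliardo_seminorm s S \<phi>)\<^sup>2 / (\<integral>x. (\<phi> x)\<^sup>2 \<partial>lborel) \<le> \<bar>frac_const DIM('a) s\<bar> / 2 * g / m"
    using I \<open>0 < m\<close> \<open>0 \<le> g\<close> by (intro frac_le) auto
  then have "ennreal ((gagliardo_seminorm s S \<phi>)\<^sup>2 / (\<integral>x. (\<phi> x)\<^sup>2 \<partial>lebesgue_on S)) \<le> ennreal (\<bar>frac_const DIM('a) s\<bar> / 2 * g / m)"
    by (simp only: test_function_square_integral(3)[OF \<phi> S]) (rule ennreal_leI)
  then show ?thesis
    unfolding poincare_const_def using mem nz by (intro INF_lower2) auto
qed

text \<open>Choose the cutoff width so small that the core keeps half the volume V of
  \<open>A\<close> and the boundary layer costs at most e V. The energy integral is then at most 2 m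
  (3 + 1) e V, with m the kernel constant, against an L^2 mass of at least V / 2.\<close>

lemma poincare_const_le_of_dist_integral:
  fixes \<Omega> W :: "'a::euclidean_space set"
  assumes s: "0 < s" "s < 1 / 2" and \<Omega>: "lipschitz_set \<Omega>" and W: "open W" "bounded W"
    and A: "A = W \<inter> \<Omega>" "0 < emeasure lborel A" and "0 < e"
    and I: "(\<integral>\<^sup>+ x. ennreal (1 / infdist x (- W) powr (2 * s)) * indicator A x \<partial>lborel) \<le> ennreal e * emeasure lborel A"
  shows "poincare_const s \<Omega> \<le> ennreal (\<bar>frac_const DIM('a) s\<bar> * (8 * enn2real (kernel_const TYPE('a) s) * e))"
proof -
  have op: "open \<Omega>" "open A" and bA: "bounded A"
    using \<Omega> W by (auto simp: lipschitz_set_def A(1) intro: bounded_subset)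
  have [measurable]: "A \<in> sets borel" using op by simp
  have W_ne: "- W \<noteq> {}" and A_ne: "- A \<noteq> {}"
    using W(2) bA by (metis Compl_UNIV_eq compl_eq_compl_iff not_bounded_UNIV)+
  define V where "V = measure lborel A"
  have EV: "emeasure lborel A = ennreal V"
    unfolding V_def using emeasure_bounded_finite[OF bA] by (intro emeasure_eq_ennreal_measure) simp
  have "V > 0" using A(2) EV by simp
  define m where "m = enn2real (kernel_const TYPE('a) s)"
  have m: "kernel_const TYPE('a) s = ennreal m" "0 \<le> m"
    using kernel_const_finite[of s, where 'a='a] s by (simp_all add: m_def)
  obtain R where R: "W \<subseteq> cball 0 R"
    using W(2) by (auto simp: bounded_iff subset_iff)
  \<comment> \<open>The boundary of \<open>\<Omega>\<close> may be unbounded, but only its part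
    within distance 1 of \<open>W\<close> matters once \<open>3 * \<delta> j < 1\<close>.\<close>
  define K where "K = frontier \<Omega> \<inter> cball 0 (R + 1)"
  have "compact K" "K \<subseteq> frontier \<Omega>"
    unfolding K_def by (auto intro: closed_Int_compact)
  from lipschitz_frontier_tube[OF \<Omega> this] obtain r C where r: "r > 0" and C: "C \<ge> 0"
    and tube: "\<And>h. 0 < h \<Longrightarrow> h < r \<Longrightarrow> emeasure lborel (\<Union>z\<in>K. ball z h) \<le> ennreal (C * h)"
    by blast
  define \<delta> where "\<delta> j = 1 / real (Suc j)" for j
  have \<delta>_pos: "\<delta> j > 0" for j by (simp add: \<delta>_def)
  have \<delta>_lim: "\<delta> \<longlonglongrightarrow> 0"
    unfolding \<delta>_def using LIMSEQ_inverse_real_of_nat by (simp add: inverse_eq_divide)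
  define core where "core j = {x \<in> A. 3 * \<delta> j \<le> infdist x (- A)}" for j
  have [measurable]: "(\<lambda>x. infdist x (- A)) \<in> borel_measurable borel"
    by (intro borel_measurable_continuous_onI continuous_intros)
  have core[measurable]: "core j \<in> sets borel" for j
    unfolding core_def by measurable
  \<comment> \<open>Since \<open>A\<close> is open, the cores increase to \<open>A\<close>, and
    continuity from below makes them eventually exceed half its volume.\<close>
  have "(\<lambda>j. emeasure lborel (core j)) \<longlonglongrightarrow> emeasure lborel (\<Union>j. core j)"
  proof (rule Lim_emeasure_incseq)
    have "\<delta> j \<le> \<delta> i" if "i \<le> j" for i j
      using that by (simp add: \<delta>_def frac_le)
    then show "incseq core"
      unfolding incseq_def core_def by fastforce
  qed auto
  also have "(\<Union>j. core j) = A"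
  proof (intro subset_antisym subsetI)
    fix x assume "x \<in> A"
    then have "0 < infdist x (- A) / 3"
      using infdist_pos_open[OF op(2) A_ne] by simp
    then have "\<forall>\<^sub>F j in sequentially. \<delta> j < infdist x (- A) / 3"
      by (rule order_tendstoD(2)[OF \<delta>_lim])
    then obtain j where "\<delta> j < infdist x (- A) / 3"
      by (auto simp: eventually_sequentially)
    with \<open>x \<in> A\<close> show "x \<in> (\<Union>j. core j)"
      by (auto simp: core_def intro!: exI[of _ j])
  qed (auto simp: core_def)
  finally have "\<forall>\<^sub>F j in sequentially. ennreal (V / 2) < emeasure lborel (core j)"
    by (rule order_tendstoD(1)) (use \<open>V > 0\<close> in \<open>simp add: EV ennreal_less_iff\<close>)
  moreover have "\<forall>\<^sub>F j in sequentially. 3 * C * \<delta> j powr (1 - 2 * s) < e * V"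
  proof -
    \<comment> \<open>This is where \<open>s < 1 / 2\<close> enters: the exponent is positive, so
      \<open>powr\<close> is continuous at 0 from the right, with value 0 there.\<close>
    have "(\<lambda>j. 3 * C * \<delta> j powr (1 - 2 * s)) \<longlonglongrightarrow> 3 * C * 0 powr (1 - 2 * s)"
      using s \<delta>_pos by (intro tendsto_intros tendsto_powr' \<delta>_lim) (auto intro!: always_eventually less_imp_le)
    then show ?thesis
      by (rule order_tendstoD(2)) (use \<open>V > 0\<close> \<open>e > 0\<close> in simp)
  qed
  moreover have "\<forall>\<^sub>F j in sequentially. \<delta> j < min r 1 / 3"
    by (rule order_tendstoD(2)[OF \<delta>_lim]) (use r in auto)
  ultimately have "\<forall>\<^sub>F j in sequentially. ennreal (V / 2) < emeasure lborel (core j) \<and>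
      3 * C * \<delta> j powr (1 - 2 * s) < e * V \<and> \<delta> j < min r 1 / 3"
    by eventually_elim simp
  then obtain j where core_j: "ennreal (V / 2) < emeasure lborel (core j)"
    and small: "3 * C * \<delta> j powr (1 - 2 * s) < e * V" and \<delta>_j: "3 * \<delta> j < r" "3 * \<delta> j < 1"
    by (auto simp: eventually_sequentially)
  obtain \<phi> where \<phi>: "\<phi> \<in> test_functions A" "\<And>x. 0 \<le> \<phi> x" "\<And>x. \<phi> x \<le> 1"
    "(1 / \<delta> j)-lipschitz_on UNIV \<phi>" "\<And>x. 3 * \<delta> j \<le> infdist x (- A) \<Longrightarrow> \<phi> x = 1"
    using smooth_cutoff_exists[OF op(2) bA \<delta>_pos] by blast
  have \<phi>\<Omega>: "\<phi> \<in> test_functions \<Omega>"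
    using \<phi>(1) test_functions_mono[of A \<Omega>] by (auto simp: A(1))
  have "A \<inter> (\<Union>z\<in>frontier \<Omega>. ball z (3 * \<delta> j)) \<subseteq> (\<Union>z\<in>K. ball z (3 * \<delta> j))"
  proof safe
    fix x z assume x: "x \<in> A" "x \<in> ball z (3 * \<delta> j)" and z: "z \<in> frontier \<Omega>"
    have "norm x \<le> R" using x R by (auto simp: A(1))
    then have "norm z \<le> R + 1"
      using x(2) \<delta>_j(2) norm_triangle_ineq[of x "z - x"] by (simp add: dist_norm)
    with x z show "x \<in> (\<Union>z\<in>K. ball z (3 * \<delta> j))"
      by (auto simp: K_def)
  qed
  then have "emeasure lborel (A \<inter> (\<Union>z\<in>frontier \<Omega>. ball z (3 * \<delta> j))) \<le> emeasure lborel (\<Union>z\<in>K. ball z (3 * \<delta> j))"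
    by (rule emeasure_mono) (auto intro!: borel_open)
  also have "\<dots> \<le> ennreal (C * (3 * \<delta> j))"
    using \<delta>_pos \<delta>_j by (intro tube) auto
  finally have "ennreal (1 / \<delta> j powr (2 * s)) * emeasure lborel (A \<inter> (\<Union>z\<in>frontier \<Omega>. ball z (3 * \<delta> j)))
      \<le> ennreal (1 / \<delta> j powr (2 * s)) * ennreal (C * (3 * \<delta> j))"
    by (rule mult_left_mono) simp
  also have "\<dots> = ennreal (3 * C * \<delta> j powr (1 - 2 * s))"
    using C \<delta>_pos[of j] by (simp add: powr_diff mult_ac flip: ennreal_mult)
  also have "\<dots> \<le> ennreal (e * V)"
    using small by (intro ennreal_leI) simp
  finally have tube_le: "ennreal (1 / \<delta> j powr (2 * s)) * emeasure lborel (A \<inter> (\<Union>z\<in>frontier \<Omega>. ball z (3 * \<delta> j)))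
      \<le> ennreal (e * V)" .
  have dist_le: "(\<integral>\<^sup>+ x. ennreal (1 / infdist x (- W) powr (2 * s)) * indicator A x \<partial>lborel) \<le> ennreal (e * V)"
    using I \<open>e > 0\<close> \<open>V > 0\<close> by (simp add: EV ennreal_mult)
  have "gagliardo_integral s \<Omega> \<phi> \<le> 2 * ennreal m * (3 * ennreal (e * V) + ennreal (e * V))"
    by (rule order_trans[OF gagliardo_integral_cutoff_le[OF s op(1) W(1) W_ne \<delta>_pos A(1) \<phi>(2-5)
            test_functions_eq_0[OF \<phi>(1)]]])
       (auto simp: m intro!: mult_left_mono add_mono dist_le tube_le)
  also have "\<dots> = ennreal (8 * m * (e * V))"
  proof -
    have t: "0 \<le> e * V" using \<open>e > 0\<close> \<open>V > 0\<close> by simp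
    have "3 * ennreal (e * V) + ennreal (e * V) = ennreal (4 * (e * V))"
      using t ennreal_mult[of 3 "e * V"] ennreal_plus[of "3 * (e * V)" "e * V"] by (simp add: mult.commute)
    moreover have "2 * ennreal m = ennreal (2 * m)"
      using m(2) ennreal_mult[of 2 m] by simp
    ultimately show ?thesis
      using t m(2) ennreal_mult[of "2 * m" "4 * (e * V)"] by (simp add: mult.assoc)
  qed
  finally have G: "gagliardo_integral s \<Omega> \<phi> \<le> ennreal (8 * m * (e * V))" .
  have "core j \<subseteq> A" by (auto simp: core_def)
  then have core_fin: "emeasure lborel (core j) < \<infinity>"
    using bA by (intro emeasure_bounded_finite) (auto intro: bounded_subset)
  then have "emeasure lborel (core j) = ennreal (measure lborel (core j))"
    by (intro emeasure_eq_ennreal_measure) simp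
  with core_j \<open>V > 0\<close> have "V / 2 \<le> measure lborel (core j)"
    by (simp add: ennreal_less_iff)
  also have "\<dots> \<le> (\<integral>x. (\<phi> x)\<^sup>2 \<partial>lborel)"
  proof -
    from core_fin have "(\<integral>x. indicator (core j) x \<partial>lborel) \<le> (\<integral>x. (\<phi> x)\<^sup>2 \<partial>lborel)"
      using op(1) \<phi>(5) by (intro integral_mono test_function_square_integral(1)[OF \<phi>\<Omega>] integrable_real_indicator)
        (auto simp: core_def indicator_def)
    then show ?thesis by simp
  qed
  finally have "V / 2 \<le> (\<integral>x. (\<phi> x)\<^sup>2 \<partial>lborel)" .
  from poincare_const_le_test_function[OF \<phi>\<Omega> _ G _ this] show ?thesis
    using \<open>V > 0\<close> \<open>e > 0\<close> m(2) op(1) by (simp add: m_def[symmetric] mult_ac)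
qed

section \<open>Passage to the limit along the dilations\<close>

theorem theorem1p4:
  fixes \<Omega> U :: "(real ^ 'n) set" and s :: real and lam :: "nat \<Rightarrow> real"
  assumes "0 < s" and "s < 1 / 2"
    and "lipschitz_set \<Omega>"
    and "lipschitz_set U" and "bounded U"
    and "\<And>k. lam k > 0" and "filterlim lam at_top sequentially"
    and "\<And>k. emeasure lebesgue ((*\<^sub>R) (lam k) ` U \<inter> \<Omega>) > 0"
    and "(\<lambda>k. (\<integral>\<^sup>+ x. ennreal (1 / infdist x (- ((*\<^sub>R) (lam k) ` U)) powr (2 * s))
                 \<partial>lebesgue_on ((*\<^sub>R) (lam k) ` U \<inter> \<Omega>))
              / emeasure lebesgue ((*\<^sub>R) (lam k) ` U \<inter> \<Omega>)) \<longlonglongrightarrow> 0"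
  shows "poincare_const s \<Omega> = 0"
proof -
  define c where "c = \<bar>frac_const DIM(real ^ 'n) s\<bar> * (8 * enn2real (kernel_const TYPE(real ^ 'n) s))"
  have "c \<ge> 0" by (simp add: c_def)
  have "poincare_const s \<Omega> \<le> 0 + ennreal \<epsilon>" if "0 < \<epsilon>" for \<epsilon>
  proof -
    \<comment> \<open>Adding 1 to the denominator covers the case \<open>c = 0\<close>.\<close>
    define e where "e = \<epsilon> / (c + 1)"
    have "e > 0" "c * e \<le> \<epsilon>"
      using \<open>c \<ge> 0\<close> \<open>\<epsilon> > 0\<close> by (auto simp: e_def field_simps)
    \<comment> \<open>The estimate is quantitative, so a single dilation with small average suffices
      for each \<open>\<epsilon>\<close>.\<close>
    from order_tendstoD(2)[OF assms(9), of "ennreal e"] \<open>e > 0\<close> obtain k where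
      k: "(\<integral>\<^sup>+ x. ennreal (1 / infdist x (- ((*\<^sub>R) (lam k) ` U)) powr (2 * s))
          \<partial>lebesgue_on ((*\<^sub>R) (lam k) ` U \<inter> \<Omega>)) / emeasure lebesgue ((*\<^sub>R) (lam k) ` U \<inter> \<Omega>) < ennreal e"
      by (auto simp: eventually_sequentially)
    define W where "W = (*\<^sub>R) (lam k) ` U"
    have W: "open W" "bounded W"
      using assms(4-6) by (auto simp: W_def lipschitz_set_def less_imp_neq[symmetric] intro: open_scaling bounded_scaling)
    have B: "W \<inter> \<Omega> \<in> sets borel"
      using W(1) assms(3) by (auto simp: lipschitz_set_def)
    have pos: "0 < emeasure lborel (W \<inter> \<Omega>)"
      using assms(8)[of k] B by (simp add: W_def)
    have fin: "emeasure lborel (W \<inter> \<Omega>) < \<infinity>"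
      using W(2) by (intro emeasure_bounded_finite) (auto intro: bounded_subset)
    let ?I = "\<integral>\<^sup>+ x. ennreal (1 / infdist x (- W) powr (2 * s)) * indicator (W \<inter> \<Omega>) x \<partial>lborel"
    have "?I / emeasure lborel (W \<inter> \<Omega>) < ennreal e"
      using k B by (simp add: W_def[symmetric] nn_integral_lebesgue_on_borel)
    then have "?I / emeasure lborel (W \<inter> \<Omega>) * emeasure lborel (W \<inter> \<Omega>) \<le> ennreal e * emeasure lborel (W \<inter> \<Omega>)"
      by (intro mult_right_mono) auto
    \<comment> \<open>Cancelling the volume in \<open>ennreal\<close> requires it to be neither 0
      nor infinite.\<close>
    also have "?I / emeasure lborel (W \<inter> \<Omega>) * emeasure lborel (W \<inter> \<Omega>) = ?I"
      using pos fin by (simp add: ennreal_divide_times ennreal_mult_divide_eq)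
    finally have "poincare_const s \<Omega> \<le> ennreal (c * e)"
      using poincare_const_le_of_dist_integral[OF assms(1-3) W refl pos \<open>e > 0\<close>]
      by (simp add: c_def mult_ac)
    also have "\<dots> \<le> ennreal \<epsilon>"
      using \<open>c * e \<le> \<epsilon>\<close> by (rule ennreal_leI)
    finally show ?thesis by simp
  qed
  then have "poincare_const s \<Omega> \<le> 0"
    by (rule ennreal_le_epsilon)
  then show ?thesis by simp
qed

end
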